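(* There exist non-Polishable ergodic full groups; that is, on a standard probability space $(X,\mu)$ there exist ergodic full groups $\mathbb G\leq\mathrm{Aut}(X,\mu)$ that admit no Polish group topology.
   Context: A standard probability space is a standard Borel space equipped with a non-atomic Borel probability measure. $\mathrm{Aut}(X,\mu)$ is the group of measure-preserving Borel bijections of $(X,\mu)$, identified when equal almost everywhere. A subgroup $\mathbb G\leq\mathrm{Aut}(X,\mu)$ is a full group if it is stable under cutting and pasting: whenever $(T_n)_{n\in\mathbb N}$ is a sequence in $\mathbb G$, $(A_n)_{n\in\mathbb N}$ is a measurable partition of $X$ and $T\in\mathrm{Aut}(X,\mu)$ satisfies $T_{\restriction A_n}=T_{n\restriction A_n}$ for all $n$, then $T\in\mathbb G$. It is ergodic if the only measurable sets $A$ with $\mu(A\triangle gA)=0$ for all $g\in\mathbb G$ are those of measure $0$ or $1$. A Polish group topology on a group is a Polish topology making it a topological group. The axiom of choice is assumed. *)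

theory Defs
  imports "HOL-Probability.Probability" "HOL-Algebra.Coset" "HOL-Algebra.Bij"
begin

definition standard_borel :: "'a measure \<Rightarrow> bool" where
  "standard_borel M \<longleftrightarrow> (\<exists>X. topspace X = space M \<and> completely_metrizable_space X \<and>
     separable_space X \<and> sets M = sigma_sets (space M) {U. openin X U})"

definition nonatomic :: "'a measure \<Rightarrow> bool" where
  "nonatomic M \<longleftrightarrow> (\<forall>A \<in> sets M. 0 < emeasure M A \<longrightarrow>
     (\<exists>B \<in> sets M. B \<subseteq> A \<and> 0 < emeasure M B \<and> emeasure M B < emeasure M A))"

definition standard_prob_space :: "'a measure \<Rightarrow> bool" where
  "standard_prob_space M \<longleftrightarrow> standard_borel M \<and> prob_space M \<and> nonatomic M"

(* Elements of BijGroup (space M) are undefined outside space M, so that two of them are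
   equal iff they agree on space M. Measurability of the inverse is automatic when M is
   standard Borel (Lusin--Souslin). *)
definition mp_bij_group :: "'a measure \<Rightarrow> ('a \<Rightarrow> 'a) monoid" where
  "mp_bij_group M = BijGroup (space M)
     \<lparr>carrier := {T \<in> Bij (space M). T \<in> measurable M M \<and>
        inv_into (space M) T \<in> measurable M M \<and> distr M M T = M}\<rparr>"

definition ae_trivial :: "'a measure \<Rightarrow> ('a \<Rightarrow> 'a) set" where
  "ae_trivial M = {T \<in> carrier (mp_bij_group M). AE x in M. T x = x}"

(* The cosets are exactly the classes of almost everywhere equality: see aut_class_eq_iff. *)
definition Aut :: "'a measure \<Rightarrow> ('a \<Rightarrow> 'a) set monoid" where
  "Aut M = mp_bij_group M Mod ae_trivial M"

definition aut_class :: "'a measure \<Rightarrow> ('a \<Rightarrow> 'a) \<Rightarrow> ('a \<Rightarrow> 'a) set" where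
  "aut_class M T = ae_trivial M #>\<^bsub>mp_bij_group M\<^esub> T"

(* As elements of Aut M are classes modulo null sets, T and S n agree on A n up to a null set. *)
definition full_group :: "'a measure \<Rightarrow> ('a \<Rightarrow> 'a) set set \<Rightarrow> bool" where
  "full_group M G \<longleftrightarrow> subgroup G (Aut M) \<and>
     (\<forall>(S :: nat \<Rightarrow> 'a \<Rightarrow> 'a) (A :: nat \<Rightarrow> 'a set). \<forall>T \<in> carrier (mp_bij_group M).
        (\<forall>n. S n \<in> carrier (mp_bij_group M) \<and> aut_class M (S n) \<in> G) \<longrightarrow>
        (\<forall>n. A n \<in> sets M) \<longrightarrow> disjoint_family A \<longrightarrow> (\<Union>n. A n) = space M \<longrightarrow>
        (\<forall>n. AE x in M. x \<in> A n \<longrightarrow> T x = S n x) \<longrightarrow>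
        aut_class M T \<in> G)"

definition ergodic :: "'a measure \<Rightarrow> ('a \<Rightarrow> 'a) set set \<Rightarrow> bool" where
  "ergodic M G \<longleftrightarrow> (\<forall>A \<in> sets M.
     (\<forall>T \<in> carrier (mp_bij_group M). aut_class M T \<in> G \<longrightarrow>
        measure M (sym_diff A (T ` A)) = 0) \<longrightarrow>
     measure M A = 0 \<or> measure M A = 1)"

definition polish_group_topology :: "('g, 'b) monoid_scheme \<Rightarrow> 'g topology \<Rightarrow> bool" where
  "polish_group_topology G X \<longleftrightarrow> topspace X = carrier G \<and>
     completely_metrizable_space X \<and> separable_space X \<and>
     continuous_map (prod_topology X X) X (\<lambda>(g, h). g \<otimes>\<^bsub>G\<^esub> h) \<and>
     continuous_map X X (\<lambda>g. inv\<^bsub>G\<^esub> g)"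

definition polishable :: "('g, 'b) monoid_scheme \<Rightarrow> bool" where
  "polishable G \<longleftrightarrow> (\<exists>X. polish_group_topology G X)"


lemma mp_bij_groupD:
  assumes "T \<in> carrier (mp_bij_group M)"
  shows "T \<in> Bij (space M)" "T \<in> measurable M M"
    "inv_into (space M) T \<in> measurable M M" "distr M M T = M"
  using assms by (auto simp: mp_bij_group_def)

lemma mp_bij_group_subgroup: "subgroup (carrier (mp_bij_group M)) (BijGroup (space M))"
proof (rule group.subgroupI[OF group_BijGroup])
  let ?S = "space M"
  show "carrier (mp_bij_group M) \<subseteq> carrier (BijGroup ?S)"
    by (auto simp: mp_bij_group_def BijGroup_def)
  have [measurable]: "(\<lambda>x\<in>?S. x) \<in> measurable M M"
    by (rule measurable_cong[THEN iffD1, OF _ measurable_ident_sets[OF refl]]) simp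
  have "inv_into ?S (\<lambda>x\<in>?S. x) x = x" if "x \<in> ?S" for x
    using that inv_into_f_f[of "\<lambda>x\<in>?S. x" ?S x] by (simp add: inj_on_def)
  then have "inv_into ?S (\<lambda>x\<in>?S. x) \<in> measurable M M"
    by (intro measurable_cong[THEN iffD1, OF _ measurable_ident_sets[OF refl]]) simp
  moreover have "distr M M (\<lambda>x\<in>?S. x) = M"
    using distr_cong[of M M M M "\<lambda>x\<in>?S. x" "\<lambda>x. x"] distr_id2[of M M] by simp
  ultimately have "(\<lambda>x\<in>?S. x) \<in> carrier (mp_bij_group M)"
    by (simp add: mp_bij_group_def id_Bij)
  then show "carrier (mp_bij_group M) \<noteq> {}" by blast
next
  let ?S = "space M"
  fix T assume T: "T \<in> carrier (mp_bij_group M)"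
  note TD = mp_bij_groupD[OF T]
  note [measurable] = TD(2,3)
  have bij: "bij_betw T ?S ?S" and ext: "T \<in> extensional ?S" using TD(1) by (auto simp: Bij_def)
  let ?R = "restrict (inv_into ?S T) ?S"
  have R: "?R \<in> measurable M M"
    by (rule measurable_cong[THEN iffD1, OF _ TD(3)]) simp
  have RB: "?R \<in> Bij ?S" using TD(1) by (rule restrict_inv_into_Bij)
  have inv_inv: "inv_into ?S ?R x = T x" if "x \<in> ?S" for x
  proof -
    have "?R (T x) = x" "T x \<in> ?S" using that bij
      by (auto simp: bij_betw_def inv_into_f_f)
    then show ?thesis using RB inv_into_f_f[of ?R ?S "T x"] by (auto simp: Bij_def bij_betw_def)
  qed
  have "inv_into ?S ?R \<in> measurable M M"
    by (rule measurable_cong[THEN iffD1, OF _ TD(2)]) (simp add: inv_inv)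
  moreover have "distr M M ?R = M"
  proof -
    have "distr M M ?R = distr (distr M M T) M ?R" by (simp add: TD(4))
    also have "\<dots> = distr M M (?R \<circ> T)" by (rule distr_distr[OF R TD(2)])
    also have "\<dots> = distr M M (\<lambda>x. x)"
      by (rule distr_cong) (use bij in \<open>auto simp: bij_betw_def inv_into_f_f\<close>)
    finally show ?thesis by (simp add: distr_id2)
  qed
  ultimately have "?R \<in> carrier (mp_bij_group M)"
    using R RB by (simp add: mp_bij_group_def)
  moreover have "inv\<^bsub>BijGroup ?S\<^esub> T = ?R"
  proof (rule group.inv_equality[OF group_BijGroup])
    show "?R \<otimes>\<^bsub>BijGroup ?S\<^esub> T = \<one>\<^bsub>BijGroup ?S\<^esub>"
      using TD(1) RB Bij_compose_restrict_eq[OF TD(1)] by (simp add: BijGroup_def)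
  qed (use TD(1) RB in \<open>simp_all add: BijGroup_def\<close>)
  ultimately show "inv\<^bsub>BijGroup ?S\<^esub> T \<in> carrier (mp_bij_group M)" by simp
next
  let ?S = "space M"
  fix T U assume T: "T \<in> carrier (mp_bij_group M)" and U: "U \<in> carrier (mp_bij_group M)"
  note TD = mp_bij_groupD[OF T] and UD = mp_bij_groupD[OF U]
  have bT: "bij_betw T ?S ?S" and bU: "bij_betw U ?S ?S" using TD(1) UD(1) by (auto simp: Bij_def)
  let ?C = "compose ?S T U"
  have CB: "?C \<in> Bij ?S" using TD(1) UD(1) by (rule compose_Bij)
  have C: "?C \<in> measurable M M"
    by (rule measurable_cong[THEN iffD1, OF _ measurable_comp[OF UD(2) TD(2)]])
      (simp add: compose_def)
  have inv: "inv_into ?S ?C x = (inv_into ?S U \<circ> inv_into ?S T) x" if x: "x \<in> ?S" for x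
  proof -
    let ?y = "inv_into ?S U (inv_into ?S T x)"
    have 1: "inv_into ?S T x \<in> ?S" "T (inv_into ?S T x) = x"
      using x bT by (auto simp: bij_betw_def inv_into_into f_inv_into_f)
    then have "?y \<in> ?S" "?C ?y = x"
      using bU by (auto simp: bij_betw_def inv_into_into f_inv_into_f compose_def)
    then show ?thesis using CB inv_into_f_f[of ?C ?S ?y] by (auto simp: Bij_def bij_betw_def)
  qed
  have "inv_into ?S ?C \<in> measurable M M"
    by (rule measurable_cong[THEN iffD1, OF _ measurable_comp[OF TD(3) UD(3)]]) (simp add: inv)
  moreover have "distr M M ?C = M"
  proof -
    have "distr M M ?C = distr M M (T \<circ> U)" by (rule distr_cong) (auto simp: compose_def)
    also have "\<dots> = distr (distr M M U) M T" by (rule distr_distr[OF TD(2) UD(2), symmetric])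
    finally show ?thesis by (simp add: UD(4) TD(4))
  qed
  ultimately show "T \<otimes>\<^bsub>BijGroup ?S\<^esub> U \<in> carrier (mp_bij_group M)"
    using CB C TD(1) UD(1) by (simp add: mp_bij_group_def BijGroup_def)
qed

lemma group_mp_bij_group: "group (mp_bij_group M)"
  using group.subgroup_imp_group[OF group_BijGroup mp_bij_group_subgroup[of M]]
  by (simp add: mp_bij_group_def)

lemma mp_bij_group_mult_apply:
  assumes "T \<in> carrier (mp_bij_group M)" "U \<in> carrier (mp_bij_group M)" "x \<in> space M"
  shows "(T \<otimes>\<^bsub>mp_bij_group M\<^esub> U) x = T (U x)"
  using assms mp_bij_groupD(1)[OF assms(1)] mp_bij_groupD(1)[OF assms(2)]
  by (simp add: mp_bij_group_def BijGroup_def compose_def)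

lemma mp_bij_group_one_apply: "x \<in> space M \<Longrightarrow> \<one>\<^bsub>mp_bij_group M\<^esub> x = x"
  by (simp add: mp_bij_group_def BijGroup_def)

lemma mp_bij_group_AE_comp:
  assumes "T \<in> carrier (mp_bij_group M)" "AE x in M. P x"
  shows "AE x in M. P (T x)"
proof -
  have "AE x in distr M M T. P x" using assms(2) by (subst mp_bij_groupD(4)[OF assms(1)])
  then show ?thesis by (rule AE_distrD[OF mp_bij_groupD(2)[OF assms(1)]])
qed

lemma mp_bij_group_AE_mult:
  assumes "T \<in> carrier (mp_bij_group M)" "U \<in> carrier (mp_bij_group M)"
  shows "AE x in M. (T \<otimes>\<^bsub>mp_bij_group M\<^esub> U) x = T (U x)"
  using mp_bij_group_mult_apply[OF assms] by (auto intro: AE_I2)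

lemma mp_bij_group_inv_apply:
  assumes T: "T \<in> carrier (mp_bij_group M)" and x: "x \<in> space M"
  shows "(inv\<^bsub>mp_bij_group M\<^esub> T) (T x) = x" "T ((inv\<^bsub>mp_bij_group M\<^esub> T) x) = x"
proof -
  interpret group "mp_bij_group M" by (rule group_mp_bij_group)
  show "(inv\<^bsub>mp_bij_group M\<^esub> T) (T x) = x"
    using mp_bij_group_mult_apply[OF inv_closed[OF T] T x] mp_bij_group_one_apply[OF x]
    by (simp add: T)
  show "T ((inv\<^bsub>mp_bij_group M\<^esub> T) x) = x"
    using mp_bij_group_mult_apply[OF T inv_closed[OF T] x] mp_bij_group_one_apply[OF x]
    by (simp add: T)
qed

lemma ae_trivial_normal: "ae_trivial M \<lhd> mp_bij_group M"
proof -
  interpret group "mp_bij_group M" by (rule group_mp_bij_group)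
  note inv_apply = mp_bij_group_inv_apply
  have "subgroup (ae_trivial M) (mp_bij_group M)"
  proof (rule subgroupI)
    show "ae_trivial M \<subseteq> carrier (mp_bij_group M)" by (auto simp: ae_trivial_def)
    show "ae_trivial M \<noteq> {}"
      using mp_bij_group_one_apply by (auto simp: ae_trivial_def intro!: AE_I2 exI[of _ "\<one>\<^bsub>mp_bij_group M\<^esub>"])
  next
    fix T assume "T \<in> ae_trivial M"
    then have T: "T \<in> carrier (mp_bij_group M)" and ae: "AE x in M. T x = x"
      by (auto simp: ae_trivial_def)
    from ae AE_space have "AE x in M. (inv\<^bsub>mp_bij_group M\<^esub> T) x = x"
      by eventually_elim (metis inv_apply(1)[OF T])
    then show "inv\<^bsub>mp_bij_group M\<^esub> T \<in> ae_trivial M" using T by (simp add: ae_trivial_def)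
  next
    fix T U assume "T \<in> ae_trivial M" "U \<in> ae_trivial M"
    then have T: "T \<in> carrier (mp_bij_group M)" "AE x in M. T x = x"
      and U: "U \<in> carrier (mp_bij_group M)" "AE x in M. U x = x"
      by (auto simp: ae_trivial_def)
    have "AE x in M. (T \<otimes>\<^bsub>mp_bij_group M\<^esub> U) x = x"
      using T(2) U(2) mp_bij_group_AE_mult[OF T(1) U(1)] by eventually_elim simp
    then show "T \<otimes>\<^bsub>mp_bij_group M\<^esub> U \<in> ae_trivial M"
      using T(1) U(1) by (simp add: ae_trivial_def)
  qed
  moreover have "U \<otimes>\<^bsub>mp_bij_group M\<^esub> T \<otimes>\<^bsub>mp_bij_group M\<^esub> inv\<^bsub>mp_bij_group M\<^esub> U \<in> ae_trivial M"
    if U: "U \<in> carrier (mp_bij_group M)" and "T \<in> ae_trivial M" for U T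
  proof -
    have T: "T \<in> carrier (mp_bij_group M)" "AE x in M. T x = x"
      using that by (auto simp: ae_trivial_def)
    have "AE x in M. T ((inv\<^bsub>mp_bij_group M\<^esub> U) x) = (inv\<^bsub>mp_bij_group M\<^esub> U) x"
      by (rule mp_bij_group_AE_comp[OF inv_closed[OF U] T(2)])
    moreover have "AE x in M. (U \<otimes>\<^bsub>mp_bij_group M\<^esub> T) ((inv\<^bsub>mp_bij_group M\<^esub> U) x)
        = U (T ((inv\<^bsub>mp_bij_group M\<^esub> U) x))"
      by (rule mp_bij_group_AE_comp[OF inv_closed[OF U] mp_bij_group_AE_mult[OF U T(1)]])
    moreover note mp_bij_group_AE_mult[OF m_closed[OF U T(1)] inv_closed[OF U]]
    ultimately have "AE x in M. (U \<otimes>\<^bsub>mp_bij_group M\<^esub> T \<otimes>\<^bsub>mp_bij_group M\<^esub> inv\<^bsub>mp_bij_group M\<^esub> U) x = x"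
      using AE_space by eventually_elim (simp add: inv_apply(2)[OF U])
    then show ?thesis using U T(1) by (simp add: ae_trivial_def)
  qed
  ultimately show ?thesis by (auto simp: normal_inv_iff)
qed

lemma group_Aut: "group (Aut M)"
  unfolding Aut_def by (rule normal.factorgroup_is_group[OF ae_trivial_normal])

lemma mem_aut_class_iff:
  assumes T: "T \<in> carrier (mp_bij_group M)"
  shows "S \<in> aut_class M T \<longleftrightarrow> S \<in> carrier (mp_bij_group M) \<and> (AE x in M. S x = T x)"
proof -
  interpret group "mp_bij_group M" by (rule group_mp_bij_group)
  note inv_apply = mp_bij_group_inv_apply
  show ?thesis
  proof safe
    assume "S \<in> aut_class M T"
    then obtain N where N: "N \<in> carrier (mp_bij_group M)" "AE x in M. N x = x"
      and S: "S = N \<otimes>\<^bsub>mp_bij_group M\<^esub> T"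
      by (auto simp: aut_class_def r_coset_def ae_trivial_def)
    show "S \<in> carrier (mp_bij_group M)" using N T S by simp
    show "AE x in M. S x = T x"
      using mp_bij_group_AE_mult[OF N(1) T] mp_bij_group_AE_comp[OF T N(2)] unfolding S
      by eventually_elim simp
  next
    assume S: "S \<in> carrier (mp_bij_group M)" and eq: "AE x in M. S x = T x"
    let ?N = "S \<otimes>\<^bsub>mp_bij_group M\<^esub> inv\<^bsub>mp_bij_group M\<^esub> T"
    have "AE x in M. ?N x = x"
      using mp_bij_group_AE_mult[OF S inv_closed[OF T]]
        mp_bij_group_AE_comp[OF inv_closed[OF T] eq] AE_space
      by eventually_elim (simp add: inv_apply(2)[OF T])
    then have "?N \<in> ae_trivial M" using S T by (simp add: ae_trivial_def)
    moreover have "S = ?N \<otimes>\<^bsub>mp_bij_group M\<^esub> T" using S T by (simp add: m_assoc)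
    ultimately show "S \<in> aut_class M T" unfolding aut_class_def r_coset_def by blast
  qed
qed

lemma aut_class_eq_iff:
  assumes "S \<in> carrier (mp_bij_group M)" "T \<in> carrier (mp_bij_group M)"
  shows "aut_class M S = aut_class M T \<longleftrightarrow> (AE x in M. S x = T x)"
proof
  assume "aut_class M S = aut_class M T"
  then show "AE x in M. S x = T x" using mem_aut_class_iff[of _ M S] mem_aut_class_iff[of _ M T] assms by auto
next
  assume eq: "AE x in M. S x = T x"
  have "(AE x in M. R x = S x) \<longleftrightarrow> (AE x in M. R x = T x)" for R :: "'a \<Rightarrow> 'a"
  proof
    assume "AE x in M. R x = S x"
    with eq show "AE x in M. R x = T x" by eventually_elim simp
  next
    assume "AE x in M. R x = T x"
    with eq show "AE x in M. R x = S x" by eventually_elim simp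
  qed
  then show "aut_class M S = aut_class M T"
    using assms by (auto simp: mem_aut_class_iff)
qed

lemma carrier_Aut: "carrier (Aut M) = aut_class M ` carrier (mp_bij_group M)"
  by (auto simp: Aut_def FactGroup_def RCOSETS_def aut_class_def)

end

theory Submission
  imports Defs
begin

text \<open>
  Up to null sets \<open>(X, \<mu>)\<close> is the circle \<open>\<real>/\<int>\<close>. Choose an uncountable group \<open>H\<close> with \<open>\<rat> \<le> H \<le> \<real>\<close> such
  that \<open>H/\<rat>\<close> is free abelian, and let \<open>\<G>\<close> be the full group generated by the rotations by elements of
  \<open>H\<close>. If an element of \<open>\<G>\<close> commutes with all rational rotations, then the set where it agrees with a
  given rotation is invariant under them, hence null or conull by ergodicity; so the centralizer in \<open>\<G>\<close>
  of the rational rotations consists of the rotations by \<open>H\<close>. A Polish group topology on \<open>\<G>\<close> would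
  make this centralizer a closed, hence Polish, uncountable subgroup. But the word length on \<open>H/\<rat>\<close> is a
  subadditive function \<open>L\<close> with \<open>L (x\<^sup>n) = n L x\<close> and \<open>L x \<in> {0} \<union> [1, \<infinity>)\<close>, and by an argument of Dudley a
  Polish group carrying such a function with countable kernel is countable.
\<close>

section \<open>Length functions on Polish groups\<close>

text \<open>A hypothetical Polish topology on the full group is arbitrary and need not be related to
  the measure, so closedness of a subgroup has to be forced algebraically. Centralizers are closed
  in every Hausdorff group topology, which is why the rotations are recovered as one. Two demands on
  \<open>H\<close> compete. Recognizing the centralizer needs an ergodic family of rotations inside
  the group, here the rational ones. But a length with these properties vanishes on divisible
  elements: if \<open>x = n y\<close> for every \<open>n\<close> with \<open>y\<close> in
  \<open>H\<close>, then \<open>L x = n L y\<close> is 0 or at least \<open>n\<close>. So \<rat>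
  must lie in the kernel, freeness is asked only of \<open>H\<close> modulo \<rat>, and the argument
  has to tolerate a countable kernel. For the same reason \<open>H\<close> cannot be all of \<real>,
  since every real is divisible there; a Hamel basis cuts out a smaller group that is still
  uncountable. The passage from an abstract standard space to the circle is made only almost
  everywhere, by two Borel maps inverse to each other off null sets; genuine bijections are restored
  afterwards.\<close>

lemma (in Metric_space) MCauchy_geometric:
  assumes M: "\<And>n. \<sigma> n \<in> M" and step: "\<And>n. d (\<sigma> n) (\<sigma> (Suc n)) \<le> (1/2) ^ n"
  shows "MCauchy \<sigma>"
proof -
  \<comment> \<open>Subtracting the remaining geometric tail makes the estimate telescope, so that
    the induction closes.\<close>
  have bound: "d (\<sigma> n) (\<sigma> (n + k)) \<le> 2 * (1/2) ^ n - 2 * (1/2) ^ (n + k)" for n k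
  proof (induction k)
    case 0
    then show ?case using M by simp
  next
    case (Suc k)
    have "d (\<sigma> n) (\<sigma> (n + Suc k)) \<le> d (\<sigma> n) (\<sigma> (n + k)) + d (\<sigma> (n + k)) (\<sigma> (Suc (n + k)))"
      using triangle[OF M M M, of n "Suc (n + k)" "n + k"] by simp
    also have "\<dots> \<le> 2 * (1/2) ^ n - 2 * (1/2) ^ (n + k) + (1/2) ^ (n + k)"
      using Suc step[of "n + k"] by simp
    finally show ?case by simp
  qed
  have le: "d (\<sigma> n) (\<sigma> n') \<le> 2 * (1/2) ^ n" if "n \<le> n'" for n n'
    using bound[of n "n' - n"] that zero_le_power[of "1/2::real" n'] by (simp del: zero_le_power)
  show ?thesis
    unfolding MCauchy_def
  proof (intro conjI allI impI)
    show "range \<sigma> \<subseteq> M" using M by auto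
    fix \<epsilon> :: real assume "\<epsilon> > 0"
    then obtain N where N: "(1/2::real) ^ N < \<epsilon> / 2"
      using real_arch_pow_inv[of "\<epsilon>/2" "1/2"] by auto
    have "d (\<sigma> n) (\<sigma> n') < \<epsilon>" if "N \<le> n" "n \<le> n'" for n n'
    proof -
      have "(1/2::real) ^ n \<le> (1/2) ^ N" by (rule power_decreasing[OF that(1)]) auto
      then show ?thesis using le[OF that(2)] N by linarith
    qed
    then have "d (\<sigma> n) (\<sigma> n') < \<epsilon>" if "N \<le> n" "N \<le> n'" for n n'
      using that commute by (metis nle_le)
    then show "\<exists>N. \<forall>n n'. N \<le> n \<longrightarrow> N \<le> n' \<longrightarrow> d (\<sigma> n) (\<sigma> n') < \<epsilon>" by blast
  qed
qed

text \<open>By separability countably many translates of a small neighbourhood cover the group, and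
  the part of \<open>C\<close> in each of them lies in a translate of \<open>C \<inter> W\<close> by
  an element of \<open>C\<close>. No closedness of \<open>C\<close> enters.\<close>

lemma polish_group_nhd_countable:
  fixes G (structure)
  assumes G: "group G" and X: "polish_group_topology G X" and C: "subgroup C G"
    and W: "openin X W" "\<one> \<in> W" "countable (C \<inter> W)"
  shows "countable C"
proof -
  interpret group G by fact
  have top: "topspace X = carrier G" and sep: "separable_space X"
    and mult: "continuous_map (prod_topology X X) X (\<lambda>(g, h). g \<otimes> h)"
    and inv: "continuous_map X X (\<lambda>g. inv g)"
    using X by (auto simp: polish_group_topology_def)
  have "continuous_map (prod_topology X X) (prod_topology X X) (\<lambda>z. (fst z, inv (snd z)))"
    by (intro continuous_map_pairedI continuous_map_fst
        continuous_map_compose[OF continuous_map_snd inv, unfolded o_def])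
  from continuous_map_compose[OF this mult]
  have "continuous_map (prod_topology X X) X (\<lambda>z. fst z \<otimes> inv (snd z))"
    by (simp add: o_def)
  from openin_continuous_map_preimage[OF this W(1)]
  have "openin (prod_topology X X) {z \<in> topspace (prod_topology X X). fst z \<otimes> inv (snd z) \<in> W}"
    (is "openin _ ?D") .
  moreover have "(\<one>, \<one>) \<in> ?D" using W(2) top by simp
  ultimately have "\<exists>U1 U2. openin X U1 \<and> openin X U2 \<and> \<one> \<in> U1 \<and> \<one> \<in> U2 \<and> U1 \<times> U2 \<subseteq> ?D"
    by (simp only: openin_prod_topology_alt)
  then obtain U1 U2 where U: "openin X U1" "openin X U2" "\<one> \<in> U1" "\<one> \<in> U2"
    and UD: "U1 \<times> U2 \<subseteq> ?D"
    by (elim exE conjE)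
  define V where "V = U1 \<inter> U2"
  have V: "openin X V" "\<one> \<in> V" using U by (auto simp: V_def)
  have VW: "v \<otimes> inv w \<in> W" if "v \<in> V" "w \<in> V" for v w
    using subsetD[OF UD, of "(v, w)"] that by (simp add: V_def)
  obtain S where S: "countable S" "X closure_of S = topspace X"
    using sep by (auto simp: separable_space_def)
  \<comment> \<open>A reference element of \<open>C\<close> close to the dense point
    \<open>s\<close>, arbitrary if there is none. Any other \<open>x\<close> in \<open>C\<close>
    close to \<open>s\<close> then satisfies \<open>inv (c s) \<otimes> x \<in> W\<close>, as a
    quotient of two elements of \<open>V\<close>.\<close>
  define c where "c s = (SOME x. x \<in> C \<and> inv x \<otimes> s \<in> V)" for s
  have "C \<subseteq> (\<Union>s\<in>S. (\<lambda>w. c s \<otimes> w) ` (C \<inter> W))"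
  proof
    fix x assume x: "x \<in> C"
    then have xG: "x \<in> carrier G" using C subgroup.mem_carrier by metis
    have "continuous_map X (prod_topology X X) (\<lambda>s. (inv x, s))"
      using xG top by (intro continuous_map_pairedI) auto
    from continuous_map_compose[OF this mult] have "continuous_map X X (\<lambda>s. inv x \<otimes> s)"
      by (simp add: o_def)
    from openin_continuous_map_preimage[OF this V(1)]
    have "openin X {s \<in> topspace X. inv x \<otimes> s \<in> V}" .
    moreover have "x \<in> {s \<in> topspace X. inv x \<otimes> s \<in> V}" using xG V top by simp
    ultimately obtain s where s: "s \<in> S" "s \<in> carrier G" "inv x \<otimes> s \<in> V"
      using S(2) top unfolding dense_intersects_open by blast
    have "c s \<in> C \<and> inv (c s) \<otimes> s \<in> V"
      unfolding c_def by (rule someI[of _ x]) (use x s in auto)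
    moreover from this have cG: "c s \<in> carrier G" using C subgroup.mem_carrier by metis
    ultimately have cs: "c s \<in> C" "inv (c s) \<otimes> s \<otimes> inv (inv x \<otimes> s) \<in> W"
      using VW[OF _ s(3)] by auto
    have "s \<otimes> (inv s \<otimes> x) = x" using xG s(2) by (simp add: m_assoc[symmetric])
    then have "inv (c s) \<otimes> s \<otimes> inv (inv x \<otimes> s) = inv (c s) \<otimes> x"
      using cG xG s(2) by (simp add: inv_mult_group m_assoc)
    then have "inv (c s) \<otimes> x \<in> W" using cs(2) by simp
    moreover have "inv (c s) \<otimes> x \<in> C"
      using C cs(1) x by (metis subgroup.m_closed subgroup.m_inv_closed)
    moreover have "x = c s \<otimes> (inv (c s) \<otimes> x)"
      using cG xG by (simp add: m_assoc[symmetric])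
    ultimately show "x \<in> (\<Union>s\<in>S. (\<lambda>w. c s \<otimes> w) ` (C \<inter> W))" using s(1) by blast
  qed
  then show ?thesis
    by (rule countable_subset) (use S(1) W(3) in auto)
qed

text \<open>
  Dudley's argument. If \<open>L\<close> is nonzero arbitrarily close to \<open>\<one>\<close>, choose \<open>g n\<close> with \<open>L (g n) \<noteq> 0\<close> tending to
  \<open>\<one>\<close> so fast that the nested products \<open>y n = g n \<otimes> (g (n+1) \<otimes> (\<dots>) [^] m (n+1)) [^] m n\<close> converge,
  where \<open>m n \<ge> L (g n) + n + 1\<close>. Then \<open>y n = g n \<otimes> y (n+1) [^] m n\<close> forces
  \<open>L (y 0) \<ge> L (y n) \<ge> n + 1\<close> for all \<open>n\<close>.
\<close>

lemma polish_group_length_countable: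
  fixes G (structure) and L :: "'a \<Rightarrow> real"
  assumes G: "group G" and X: "polish_group_topology G X"
    and C: "subgroup C G" and closed: "closedin X C"
    and L_mult: "\<And>x y. x \<in> C \<Longrightarrow> y \<in> C \<Longrightarrow> L (x \<otimes> y) \<le> L x + L y"
    and L_inv: "\<And>x. x \<in> C \<Longrightarrow> L (inv x) = L x"
    and L_pow: "\<And>x n. x \<in> C \<Longrightarrow> L (x [^] (n::nat)) = real n * L x"
    and L_gap: "\<And>x. x \<in> C \<Longrightarrow> L x = 0 \<or> L x \<ge> 1"
    and L_ker: "countable {x \<in> C. L x = 0}"
  shows "countable C"
proof (rule ccontr)
  assume unc: "uncountable C"
  interpret group G by fact
  interpret C: subgroup C G by fact
  have top: "topspace X = carrier G"
    and mult: "continuous_map (prod_topology X X) X (\<lambda>(g, h). g \<otimes> h)"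
    using X by (auto simp: polish_group_topology_def)
  obtain M d where "Metric_space M d" "Metric_space.mcomplete M d" and Xeq: "X = Metric_space.mtopology M d"
    using X by (auto simp: polish_group_topology_def completely_metrizable_space_def)
  then interpret Metric_space M d by simp
  have M: "M = carrier G" using top Xeq by simp
  have complete: "mcomplete" by fact
  \<comment> \<open>Otherwise \<open>C \<inter> W\<close> lies in the countable kernel of
    \<open>L\<close>, which would make all of \<open>C\<close> countable.\<close>
  have small: "\<exists>g\<in>C. g \<in> W \<and> L g \<noteq> 0" if "openin X W" "\<one> \<in> W" for W
  proof (rule ccontr)
    assume "\<not> ?thesis"
    then have "C \<inter> W \<subseteq> {x \<in> C. L x = 0}" by auto
    then show False
      using polish_group_nhd_countable[OF G X C that] unc L_ker countable_subset by blast
  qed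
  have pow_cont: "continuous_map X X (\<lambda>y. y [^] (k::nat))" for k
  proof (induction k)
    case 0
    then show ?case using top by simp
  next
    case (Suc k)
    have "continuous_map X (prod_topology X X) (\<lambda>y. (y [^] k, y))"
      by (intro continuous_map_pairedI Suc) auto
    from continuous_map_compose[OF this mult] show ?case by (simp add: o_def)
  qed
  define m where "m N g = nat \<lceil>L g\<rceil> + N + 1" for N g
  define \<phi> where "\<phi> N g y = g \<otimes> y [^] m N g" for N g y
  have \<phi>_cont: "continuous_map X X (\<phi> N g)" if "g \<in> C" for N g
  proof -
    have "continuous_map X (prod_topology X X) (\<lambda>y. (g, y [^] m N g))"
      using that C.subset top by (intro continuous_map_pairedI pow_cont) auto
    from continuous_map_compose[OF this mult] show ?thesis by (simp add: o_def \<phi>_def[abs_def])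
  qed
  have powC: "y [^] (k::nat) \<in> C" if "y \<in> C" for y k
    using that by (induction k) auto
  have \<phi>_C: "\<phi> N g y \<in> C" if "g \<in> C" "y \<in> C" for N g y
    using that powC by (simp add: \<phi>_def)
  \<comment> \<open>A state at stage \<open>N\<close> is the pair of \<open>g N\<close> and the maps \<open>\<Phi> N n = \<phi>\<^sub>n \<circ> \<dots> \<circ> \<phi>\<^sub>N\<close> for \<open>n \<le> N\<close>; the values for \<open>n > N\<close> are junk.\<close>
  define P where "P N s \<longleftrightarrow> fst s \<in> C \<and> L (fst s) \<noteq> 0 \<and>
    (\<forall>n. continuous_map X X (snd s n) \<and> snd s n ` C \<subseteq> C)" for N :: nat and s :: "'a \<times> (nat \<Rightarrow> 'a \<Rightarrow> 'a)"
  \<comment> \<open>Truncating the nested product means feeding \<open>\<one>\<close> into the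
    innermost map. Since \<open>\<phi> (Suc N) g \<one> = g\<close>, passing to the next truncation
    replaces the argument \<open>\<one>\<close> of \<open>snd s n\<close> by the new
    \<open>g\<close>; the bound therefore controls consecutive truncations. Only finitely many
    \<open>n\<close> are constrained at each stage, so a neighbourhood of \<open>\<one>\<close>
    achieves it by continuity.\<close>
  define Q where "Q N s t \<longleftrightarrow>
    (\<forall>n. snd t n = (if n \<le> N then snd s n \<circ> \<phi> (Suc N) (fst t) else \<phi> (Suc N) (fst t))) \<and>
    (\<forall>n\<le>N. d (snd s n \<one>) (snd s n (fst t)) < (1/2) ^ N)" for N and s t :: "'a \<times> (nat \<Rightarrow> 'a \<Rightarrow> 'a)"
  obtain g0 where g0: "g0 \<in> C" "L g0 \<noteq> 0"
    using small[OF openin_topspace] top by auto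
  have ex: "\<exists>f. \<forall>N. (P N (f N) \<and> (N = 0 \<longrightarrow> snd (f N) = (\<lambda>n. \<phi> 0 (fst (f N))))) \<and> Q N (f N) (f (Suc N))"
  proof (rule dependent_nat_choice)
    show "\<exists>s. P 0 s \<and> (0 = 0 \<longrightarrow> snd s = (\<lambda>n. \<phi> 0 (fst s)))"
      using g0 \<phi>_C \<phi>_cont by (intro exI[of _ "(g0, \<lambda>n. \<phi> 0 g0)"]) (auto simp: P_def)
  next
    fix s N assume "P N s \<and> (N = 0 \<longrightarrow> snd s = (\<lambda>n. \<phi> 0 (fst s)))"
    then have P: "P N s" by simp
    define W where "W = (\<Inter>n\<in>{..N}. {g \<in> topspace X. snd s n g \<in> mball (snd s n \<one>) ((1/2)^N)})"
    have s1: "snd s n \<one> \<in> M" for n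
      using P C.one_closed C.subset M by (auto simp: P_def image_subset_iff)
    have sC: "continuous_map X X (snd s n)" "snd s n ` C \<subseteq> C" for n
      using P by (simp_all add: P_def)
    have "openin X {g \<in> topspace X. snd s n g \<in> mball (snd s n \<one>) ((1/2)^N)}" for n
      by (rule openin_continuous_map_preimage[OF sC(1)]) (simp add: Xeq)
    then have "openin X W" unfolding W_def by (intro openin_INT2) auto
    moreover have "\<one> \<in> W" using s1 top by (auto simp: W_def)
    ultimately obtain g where g: "g \<in> C" "g \<in> W" "L g \<noteq> 0" using small by blast
    let ?t = "(g, \<lambda>n. if n \<le> N then snd s n \<circ> \<phi> (Suc N) g else \<phi> (Suc N) g)"
    have "P (Suc N) ?t"
      unfolding P_def
    proof (intro conjI allI)
      fix n
      show "continuous_map X X (snd ?t n)"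
        using continuous_map_compose[OF \<phi>_cont[OF g(1)] sC(1)] \<phi>_cont[OF g(1)] by simp
      show "snd ?t n ` C \<subseteq> C"
        using \<phi>_C[OF g(1)] sC(2)[of n] by auto
    qed (use g in auto)
    moreover have "Q N s ?t"
      using g(2) by (auto simp: Q_def W_def)
    ultimately show "\<exists>t. (P (Suc N) t \<and> (Suc N = 0 \<longrightarrow> snd t = (\<lambda>n. \<phi> 0 (fst t)))) \<and> Q N s t" by blast
  qed
  obtain f where f0: "\<forall>N. (P N (f N) \<and> (N = 0 \<longrightarrow> snd (f N) = (\<lambda>n. \<phi> 0 (fst (f N))))) \<and> Q N (f N) (f (Suc N))"
    using ex by (rule exE)
  have f: "\<And>N. P N (f N)" "snd (f 0) = (\<lambda>n. \<phi> 0 (fst (f 0)))" "\<And>N. Q N (f N) (f (Suc N))"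
    using f0 by auto
  define g where "g N = fst (f N)" for N
  define \<Phi> where "\<Phi> N = snd (f N)" for N
  have g: "g N \<in> C" "L (g N) \<noteq> 0" for N using f(1) by (auto simp: g_def P_def)
  have \<Phi>_C: "\<Phi> N n x \<in> C" if "x \<in> C" for N n x using f(1)[of N] that by (auto simp: \<Phi>_def P_def)
  have \<Phi>_Suc: "\<Phi> (Suc N) n = (if n \<le> N then \<Phi> N n \<circ> \<phi> (Suc N) (g (Suc N)) else \<phi> (Suc N) (g (Suc N)))" for N n
    using f(3) by (simp add: Q_def \<Phi>_def g_def)
  have \<Phi>_diag: "\<Phi> n n = \<phi> n (g n)" for n
    by (cases n) (simp_all add: \<Phi>_Suc, simp add: \<Phi>_def g_def f(2))
  have \<Phi>_step: "\<Phi> (Suc N) n x = \<Phi> N n (\<phi> (Suc N) (g (Suc N)) x)" if "n \<le> N" for N n x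
    using that by (simp add: \<Phi>_Suc)
  \<comment> \<open>The maps \<open>\<Phi>\<close> grow by composing on the inside, whereas the
    recursion for the limits peels off the outermost factor; the two bracketings agree.\<close>
  have \<Phi>_shift: "\<Phi> (N + Suc n) n x = \<phi> n (g n) (\<Phi> (N + Suc n) (Suc n) x)" for N n x
  proof (induction N arbitrary: x)
    case 0
    show ?case using \<Phi>_step[of n n x] by (simp add: \<Phi>_diag)
  next
    case (Suc N)
    show ?case
      using \<Phi>_step[of n "N + Suc n" x] \<Phi>_step[of "Suc n" "N + Suc n" x] Suc by simp
  qed
  have "\<exists>y. limitin X (\<lambda>N. \<Phi> (N + n) n \<one>) y sequentially" for n
  proof -
    have inM: "\<Phi> N n \<one> \<in> M" for N
      using \<Phi>_C[OF C.one_closed, of N n] C.subset M by auto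
    have "MCauchy (\<lambda>N. \<Phi> (N + n) n \<one>)"
    proof (rule MCauchy_geometric)
      fix N
      have "\<phi> (Suc (N + n)) (g (Suc (N + n))) \<one> = g (Suc (N + n))"
        using g C.subset by (auto simp: \<phi>_def)
      then have "\<Phi> (Suc N + n) n \<one> = \<Phi> (N + n) n (g (Suc (N + n)))"
        by (simp add: \<Phi>_Suc)
      then have "d (\<Phi> (N + n) n \<one>) (\<Phi> (Suc N + n) n \<one>) < (1/2) ^ (N + n)"
        using f(3)[of "N + n"] by (simp add: Q_def \<Phi>_def g_def)
      also have "\<dots> \<le> (1/2) ^ N" by (rule power_decreasing) auto
      finally show "d (\<Phi> (N + n) n \<one>) (\<Phi> (Suc N + n) n \<one>) \<le> (1/2) ^ N" by simp
    qed (rule inM)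
    then show ?thesis using complete by (simp add: mcomplete_def Xeq)
  qed
  then have "\<forall>n. \<exists>y. limitin X (\<lambda>N. \<Phi> (N + n) n \<one>) y sequentially" ..
  then obtain y where "\<forall>n. limitin X (\<lambda>N. \<Phi> (N + n) n \<one>) (y n) sequentially"
    by (drule_tac choice) (rule exE)
  then have y: "limitin X (\<lambda>N. \<Phi> (N + n) n \<one>) (y n) sequentially" for n ..
  \<comment> \<open>Closedness of \<open>C\<close> is used here: the hypotheses on \<open>L\<close>
    hold on \<open>C\<close> only, so the limits must stay inside.\<close>
  have yC: "y n \<in> C" for n
    using limitin_closedin[OF y closed] \<Phi>_C by simp
  have uniq: "l1 = l2" if "limitin X \<sigma> l1 sequentially" "limitin X \<sigma> l2 sequentially" for \<sigma> l1 l2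
    by (rule limitin_metric_unique[OF that[unfolded Xeq] sequentially_bot])
  have y_rec: "y n = g n \<otimes> y (Suc n) [^] m n (g n)" for n
  proof -
    have "limitin X (\<lambda>N. \<Phi> (N + Suc n) n \<one>) (y n) sequentially"
      using limitin_sequentially_offset[OF y[of n], of 1] by simp
    moreover have "limitin X (\<phi> n (g n) \<circ> (\<lambda>N. \<Phi> (N + Suc n) (Suc n) \<one>)) (\<phi> n (g n) (y (Suc n))) sequentially"
      by (rule continuous_map_limit[OF \<phi>_cont[OF g(1)] y])
    moreover have "\<phi> n (g n) \<circ> (\<lambda>N. \<Phi> (N + Suc n) (Suc n) \<one>) = (\<lambda>N. \<Phi> (N + Suc n) n \<one>)"
      by (rule ext) (simp only: o_apply \<Phi>_shift[of _ n])
    ultimately have "y n = \<phi> n (g n) (y (Suc n))" using uniq by simp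
    then show ?thesis by (simp add: \<phi>_def)
  qed
  have L_nonneg: "L x \<ge> 0" if "x \<in> C" for x using L_gap[OF that] by auto
  \<comment> \<open>Cancelling \<open>g n\<close> costs an error \<open>L (g n)\<close>. The summand
    \<open>nat \<lceil>L (g n)\<rceil>\<close> of the exponent pays for it, because a nonzero
    \<open>L (y (Suc n))\<close> is at least 1.\<close>
  have grow: "L (y n) \<ge> real (n + 1) * L (y (Suc n))" for n
  proof -
    let ?m = "m n (g n)"
    have [simp]: "g n \<in> carrier G" "y (Suc n) \<in> carrier G" using g yC C.subset by auto
    have "real ?m = real (nat \<lceil>L (g n)\<rceil>) + real (n + 1)" by (simp add: m_def)
    then have m: "L (g n) + real (n + 1) \<le> real ?m"
      using real_nat_ceiling_ge[of "L (g n)"] by linarith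
    have "inv (g n) \<otimes> y n = inv (g n) \<otimes> (g n \<otimes> y (Suc n) [^] ?m)"
      by (simp only: y_rec[of n])
    also have "\<dots> = y (Suc n) [^] ?m" by (simp flip: m_assoc)
    finally have "y (Suc n) [^] ?m = inv (g n) \<otimes> y n" ..
    then have "L (y (Suc n) [^] ?m) \<le> L (inv (g n)) + L (y n)"
      using L_mult[of "inv (g n)" "y n"] g yC by simp
    then have *: "real ?m * L (y (Suc n)) \<le> L (g n) + L (y n)"
      by (simp only: L_inv[OF g(1)] L_pow[OF yC])
    show ?thesis
    proof (cases "L (y (Suc n)) = 0")
      case True
      then show ?thesis using L_nonneg[OF yC, of n] by simp
    next
      case False
      then have ge: "1 \<le> L (y (Suc n))" using L_gap[OF yC] by blast
      have "(L (g n) + real (n + 1)) * L (y (Suc n)) \<le> real ?m * L (y (Suc n))"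
        by (rule mult_right_mono) (use m ge in auto)
      moreover have "L (g n) * 1 \<le> L (g n) * L (y (Suc n))"
        by (rule mult_left_mono[OF ge L_nonneg[OF g(1)]])
      moreover have "(L (g n) + real (n + 1)) * L (y (Suc n))
          = L (g n) * L (y (Suc n)) + real (n + 1) * L (y (Suc n))" by (rule distrib_right)
      ultimately show ?thesis using * by linarith
    qed
  qed
  \<comment> \<open>This is where \<open>L (g n) \<noteq> 0\<close> matters: if
    \<open>y (Suc n)\<close> has length 0, so does its power, and \<open>y n\<close> is at least as
    long as \<open>g n\<close>.\<close>
  have pos: "L (y n) \<ge> 1" for n
  proof (cases "L (y (Suc n)) = 0")
    case True
    have *: "y (Suc n) [^] m n (g n) \<in> C" (is "?z \<in> C") by (rule powC[OF yC])
    have [simp]: "g n \<in> carrier G" "?z \<in> carrier G" using g(1)[of n] * C.subset by blast+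
    have "y n \<otimes> inv ?z = g n \<otimes> ?z \<otimes> inv ?z" by (simp only: y_rec[of n])
    also have "\<dots> = g n" by (simp add: m_assoc)
    finally have "L (g n) = L (y n \<otimes> inv ?z)" by simp
    also have "\<dots> \<le> L (y n) + L (inv ?z)" by (rule L_mult[OF yC C.m_inv_closed[OF *]])
    finally have "L (g n) \<le> L (y n)" using L_inv[OF *] L_pow[OF yC] True by simp
    then show ?thesis using L_gap[OF g(1), of n] g(2)[of n] by linarith
  next
    case False
    then have "1 \<le> L (y (Suc n))" using L_gap[OF yC] by blast
    then have "1 * 1 \<le> real (n + 1) * L (y (Suc n))" by (intro mult_mono) auto
    also have "\<dots> \<le> L (y n)" by (rule grow)
    finally show ?thesis by simp
  qed
  have "L (y 0) \<ge> L (y n)" for n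
  proof (induction n)
    case (Suc n)
    have "1 * L (y (Suc n)) \<le> real (n + 1) * L (y (Suc n))"
      by (intro mult_right_mono) (use pos[of "Suc n"] in auto)
    also have "\<dots> \<le> L (y n)" by (rule grow)
    finally show ?case using Suc by simp
  qed simp
  moreover have "L (y n) \<ge> real (n + 1)" for n
  proof -
    have "real (n + 1) * 1 \<le> real (n + 1) * L (y (Suc n))" by (rule mult_left_mono[OF pos]) simp
    also have "\<dots> \<le> L (y n)" by (rule grow)
    finally show ?thesis by simp
  qed
  ultimately have le: "real (n + 1) \<le> L (y 0)" for n by (rule order_trans[rotated])
  obtain n where "L (y 0) < real n" using reals_Archimedean2 by blast
  then show False using le[of n] by simp
qed

section \<open>A group of reals that is free abelian modulo the rationals\<close>

interpretation real_rat: vector_space "\<lambda>(q::rat) (x::real). of_rat q * x"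
  by unfold_locales (simp_all add: algebra_simps of_rat_add of_rat_mult)

text \<open>\<open>L\<close> is the l1 norm of the Hamel coordinates other than the one at 1. It has
  all the required properties on the whole of \<real> except the gap; \<open>H\<close> is cut out by
  integrality to obtain it, as a nonzero integral coordinate contributes at least 1. Clearing the
  finitely many denominators shows that every real is \<open>h / n\<close> with \<open>h\<close> in
  \<open>H\<close>, whence \<open>H\<close> is uncountable.\<close>

lemma uncountable_real_subgroup_length:
  obtains H :: "real set" and L :: "real \<Rightarrow> real"
  where "\<rat> \<subseteq> H" "uncountable H"
    "\<And>x y. x \<in> H \<Longrightarrow> y \<in> H \<Longrightarrow> x + y \<in> H" "\<And>x. x \<in> H \<Longrightarrow> - x \<in> H"
    "\<And>x y. L (x + y) \<le> L x + L y" "\<And>x. L (- x) = L x" "\<And>n x. L (real n * x) = real n * L x"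
    "\<And>x. x \<in> H \<Longrightarrow> L x = 0 \<or> 1 \<le> L x" "\<And>x. L x = 0 \<longleftrightarrow> x \<in> \<rat>"
proof -
  define B where "B = real_rat.extend_basis {1}"
  have ind1: "real_rat.independent {1}" by simp
  note ind = real_rat.independent_extend_basis[OF ind1, folded B_def]
  note span = real_rat.span_extend_basis[OF ind1, folded B_def]
  have oneB: "1 \<in> B" using real_rat.extend_basis_superset[OF ind1] by (simp add: B_def)
  define r where "r = real_rat.representation B"
  have fin: "finite {b. r x b \<noteq> 0}" for x by (simp add: r_def real_rat.finite_representation)
  have r_add: "r (x + y) b = r x b + r y b" for x y b
    by (simp add: r_def real_rat.representation_add[OF ind] span)
  have r_scale: "r (of_rat q * x) b = q * r x b" for q x b
    by (simp add: r_def real_rat.representation_scale[OF ind] span)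
  have r_minus: "r (- x) b = - r x b" for x b using r_scale[of "-1" x b] by (simp add: of_rat_minus)
  have r_nat: "r (real n * x) b = of_nat n * r x b" for n x b using r_scale[of "of_nat n" x b] by simp
  have r_one: "r 1 b = (if b = 1 then 1 else 0)" for b
    by (simp add: r_def real_rat.representation_basis[OF ind oneB])
  have sum_r: "(\<Sum>b | r x b \<noteq> 0. of_rat (r x b) * b) = x" for x
    using real_rat.sum_nonzero_representation_eq[OF ind, of x] by (simp add: r_def span)
  \<comment> \<open>In a Hamel basis containing 1, only the coordinate at 1 may be non-integral.\<close>
  define H where "H = {x. \<forall>b. b \<noteq> 1 \<longrightarrow> r x b \<in> \<int>}"
  define L where "L x = (\<Sum>b | r x b \<noteq> 0. if b = 1 then 0 else \<bar>real_of_rat (r x b)\<bar>)" for x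
  have L_sup: "L x = (\<Sum>b\<in>S. if b = 1 then 0 else \<bar>real_of_rat (r x b)\<bar>)"
    if "finite S" "{b. r x b \<noteq> 0} \<subseteq> S" for S x
    unfolding L_def by (rule sum.mono_neutral_left) (use that in auto)
  have rat_rep: "r (of_rat q) b = (if b = 1 then q else 0)" for q b
    using r_scale[of q 1 b] by (simp add: r_one)
  show thesis
  proof
    show "\<rat> \<subseteq> H" by (auto simp: H_def Rats_def rat_rep)
    show "x + y \<in> H" if "x \<in> H" "y \<in> H" for x y using that by (auto simp: H_def r_add)
    show "- x \<in> H" if "x \<in> H" for x using that by (auto simp: H_def r_minus)
    show "L (x + y) \<le> L x + L y" for x y
    proof -
      let ?S = "{b. r x b \<noteq> 0} \<union> {b. r y b \<noteq> 0}"
      have S: "finite ?S" using fin by simp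
      have "L (x + y) = (\<Sum>b\<in>?S. if b = 1 then 0 else \<bar>real_of_rat (r (x + y) b)\<bar>)"
        by (rule L_sup[OF S]) (auto simp: r_add)
      also have "\<dots> \<le> (\<Sum>b\<in>?S. (if b = 1 then 0 else \<bar>real_of_rat (r x b)\<bar>) + (if b = 1 then 0 else \<bar>real_of_rat (r y b)\<bar>))"
        by (intro sum_mono) (auto simp: r_add of_rat_less_eq abs_triangle_ineq simp flip: of_rat_add)
      also have "\<dots> = L x + L y"
        unfolding sum.distrib using L_sup[OF S, of x] L_sup[OF S, of y] by simp
      finally show ?thesis .
    qed
    show "L (- x) = L x" for x by (simp add: L_def r_minus of_rat_minus cong: if_cong)
    show "L (real n * x) = real n * L x" for n x
    proof -
      have "L (real n * x) = (\<Sum>b | r x b \<noteq> 0. if b = 1 then 0 else \<bar>real_of_rat (r (real n * x) b)\<bar>)"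
        by (rule L_sup[OF fin]) (auto simp: r_nat)
      also have "\<dots> = real n * L x"
        unfolding L_def sum_distrib_left by (intro sum.cong) (auto simp: r_nat of_rat_mult abs_mult)
      finally show ?thesis .
    qed
    show L0: "L x = 0 \<longleftrightarrow> x \<in> \<rat>" for x
    proof
      assume "L x = 0"
      then have z: "(if b = 1 then 0 else \<bar>real_of_rat (r x b)\<bar>) = 0" if "r x b \<noteq> 0" for b
        unfolding L_def by (subst (asm) sum_nonneg_eq_0_iff[OF fin]) (use that in auto)
      have "r x b = 0" if "b \<noteq> 1" for b
      proof (rule ccontr)
        assume "r x b \<noteq> 0"
        from z[OF this] this that show False by simp
      qed
      then have "{b. r x b \<noteq> 0} \<subseteq> {1}" by auto
      then have "(\<Sum>b | r x b \<noteq> 0. of_rat (r x b) * b) = (\<Sum>b\<in>{1::real}. of_rat (r x b) * b)"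
        by (intro sum.mono_neutral_left) auto
      also have "\<dots> = of_rat (r x 1)" by simp
      finally show "x \<in> \<rat>" using sum_r[of x] by (metis Rats_of_rat)
    next
      assume "x \<in> \<rat>"
      then show "L x = 0" by (auto simp: L_def Rats_def rat_rep intro!: sum.neutral)
    qed
    show "L x = 0 \<or> 1 \<le> L x" if x: "x \<in> H" for x
    proof (cases "\<exists>b. b \<noteq> 1 \<and> r x b \<noteq> 0")
      case True
      then obtain b where b: "b \<noteq> 1" "r x b \<noteq> 0" by blast
      then obtain i where i: "r x b = of_int i" using x by (auto simp: H_def elim: Ints_cases)
      have "i \<noteq> 0" using b i by auto
      then have "1 \<le> \<bar>real_of_int i\<bar>" by linarith
      then have "1 \<le> \<bar>real_of_rat (r x b)\<bar>" by (simp only: i of_rat_of_int_eq)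
      also have "\<dots> = (\<Sum>b\<in>{b}. if b = 1 then 0 else \<bar>real_of_rat (r x b)\<bar>)" using b by simp
      also have "\<dots> \<le> L x" unfolding L_def by (rule sum_mono2[OF fin]) (use b in auto)
      finally show ?thesis by simp
    qed (auto simp: L_def intro!: sum.neutral)
    show "uncountable H"
    proof
      assume H: "countable H"
      have "x \<in> (\<Union>n. (\<lambda>h. h / real n) ` H)" for x
      proof -
        define n where "n = (\<Prod>b | r x b \<noteq> 0. nat (snd (quotient_of (r x b))))"
        have pos: "nat (snd (quotient_of q)) > 0" for q using quotient_of_denom_pos'[of q] by simp
        have n: "n > 0" unfolding n_def using pos by (intro prod_pos) simp
        have "of_nat n * r x b \<in> \<int>" for b
        proof (cases "r x b = 0")
          case False
          obtain p d where pd: "quotient_of (r x b) = (p, d)" by fastforce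
          then have d: "d > 0" and eq: "r x b = of_int p / of_int d"
            using quotient_of_denom_pos quotient_of_div by blast+
          have "nat (snd (quotient_of (r x b))) dvd n"
            unfolding n_def using False fin by (intro dvd_prodI) auto
          then obtain k where k: "n = nat d * k" using pd by auto
          have "of_nat n * r x b = of_int (int k * p)"
            using d by (simp add: k eq of_nat_nat)
          then show ?thesis by (metis Ints_of_int)
        qed simp
        then have "real n * x \<in> H" by (simp add: H_def r_nat)
        then show ?thesis using n by (intro UN_I[of n] image_eqI[of _ _ "real n * x"]) auto
      qed
      then have "UNIV = (\<Union>n. (\<lambda>h. h / real n) ` H)" by auto
      moreover have "countable (\<Union>n. (\<lambda>h. h / real n) ` H)" using H by auto
      ultimately show False using uncountable_UNIV_real by simp
    qed
  qed
qed

section \<open>Rotations of the circle\<close>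

text \<open>Stands for the circle, with \<open>frac\<close> as reduction modulo 1. The underlying
  space remains all of \<real>, so Borel maps on the line need no restriction, and points outside
  the unit interval form a null set.\<close>

abbreviation uniform01 :: "real measure" where
  "uniform01 \<equiv> uniform_measure lborel {0..<1}"

lemma prob_space_uniform01: "prob_space uniform01"
  by (rule prob_space_uniform_measure) auto

lemma emeasure_uniform01: "A \<in> sets borel \<Longrightarrow> emeasure uniform01 A = emeasure lborel ({0..<1} \<inter> A)"
  by (simp add: divide_ennreal_def)

lemma AE_uniform01_bounds: "AE t in uniform01. 0 < t \<and> t < 1"
proof -
  have "AE t::real in lborel. t \<in> {0..<1} \<longrightarrow> 0 < t \<and> t < 1"
    using AE_lborel_singleton[of "0::real"] by eventually_elim auto
  then show ?thesis by (simp add: AE_uniform_measure)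
qed

lemma borel_measurable_frac[measurable]: "(frac :: real \<Rightarrow> real) \<in> borel_measurable borel"
  unfolding frac_def by measurable

lemma frac_add_frac: "frac (frac x + y) = frac (x + y)"
  by (simp add: frac_def diff_add_eq)

lemma frac_eq_imp_diff_Ints:
  assumes "frac x = frac y"
  shows "x - y \<in> \<int>"
proof -
  have "x - y = of_int (\<lfloor>x\<rfloor> - \<lfloor>y\<rfloor>)" using assms by (simp add: frac_def algebra_simps)
  then show ?thesis by (metis Ints_of_int)
qed

text \<open>A rotation exchanges two intervals: with \<open>a = frac h\<close> it translates by
  \<open>a\<close> to the left of \<open>1 - a\<close> and by \<open>a - 1\<close> to the right. The
  preimage of a set thus splits into two translated pieces, and translation invariance of Lebesgue
  measure applies to each.\<close>

lemma distr_uniform01_rotation: "distr uniform01 borel (\<lambda>t. frac (t + h)) = uniform01"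
proof (rule measure_eqI)
  fix A assume "A \<in> sets (distr uniform01 borel (\<lambda>t. frac (t + h)))"
  then have A[measurable]: "A \<in> sets borel" by simp
  define a where "a = frac h"
  have a: "0 \<le> a" "a < 1" by (auto simp: a_def frac_lt_1)
  have frac_eq: "frac (t + h) = (if t < 1 - a then t + a else t + (a - 1))" if "t \<in> {0..<1}" for t
  proof -
    have "frac (t + h) = frac (t + a)"
      using frac_add_frac[of h t] by (simp add: a_def add.commute)
    also have "\<dots> = (if t < 1 - a then t + a else t + (a - 1))"
    proof (cases "t < 1 - a")
      case True
      then show ?thesis using that a by (simp add: frac_eq)
    next
      case False
      then have "\<lfloor>t + a\<rfloor> = 1" using that a by (intro floor_unique) auto
      then show ?thesis using False by (simp add: frac_def)
    qed
    finally show ?thesis .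
  qed
  have shift: "emeasure lborel ((\<lambda>t. c + t) -` B) = emeasure lborel B" if "B \<in> sets borel" for c :: real and B
    using that by (subst (2) lborel_distr_plus[of c, symmetric]) (simp add: emeasure_distr)
  have m: "(\<lambda>t. c + t) -` B \<in> sets lborel" if "B \<in> sets borel" for c :: real and B
    using measurable_sets[of "\<lambda>t. c + t" borel borel B] that by simp
  let ?P = "(\<lambda>t. frac (t + h)) -` A"
  have [measurable]: "(\<lambda>t. frac (t + h)) \<in> borel_measurable borel" by measurable
  have "?P \<in> sets borel"
    using measurable_sets[of "\<lambda>t. frac (t + h)" borel borel A] by simp
  then have "emeasure (distr uniform01 borel (\<lambda>t. frac (t + h))) A = emeasure lborel ({0..<1} \<inter> ?P)"
    by (subst emeasure_distr) (simp_all add: divide_ennreal_def)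
  also have "{0..<1} \<inter> ?P = (\<lambda>t. a + t) -` (A \<inter> {a..<1}) \<union> (\<lambda>t. (a - 1) + t) -` (A \<inter> {0..<a})"
    using a by (auto simp: frac_eq add.commute algebra_simps split: if_splits)
  also have "emeasure lborel \<dots> = emeasure lborel ((\<lambda>t. a + t) -` (A \<inter> {a..<1}))
      + emeasure lborel ((\<lambda>t. (a - 1) + t) -` (A \<inter> {0..<a}))"
    by (rule plus_emeasure[symmetric]) (use m[of "A \<inter> {a..<1}" a] m[of "A \<inter> {0..<a}" "a - 1"] in auto)
  also have "\<dots> = emeasure lborel (A \<inter> {a..<1}) + emeasure lborel (A \<inter> {0..<a})"
    by (intro arg_cong2[where f = "(+)"] shift) simp_all
  also have "\<dots> = emeasure lborel ((A \<inter> {a..<1}) \<union> (A \<inter> {0..<a}))"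
    by (rule plus_emeasure) auto
  also have "(A \<inter> {a..<1}) \<union> (A \<inter> {0..<a}) = {0..<1} \<inter> A" using a by auto
  finally show "emeasure (distr uniform01 borel (\<lambda>t. frac (t + h))) A = emeasure uniform01 A"
    by (simp only: emeasure_uniform01[OF A])
qed simp

text \<open>Rotation by \<open>k / n\<close> carries the slice of \<open>A\<close> over the first
  interval of length \<open>1 / n\<close> to the slice over the \<open>k\<close>-th one, so all
  \<open>n\<close> slices have equal measure. This gives the claim at rational points, and
  monotonicity extends it to real \<open>x\<close>.\<close>

lemma uniform01_rotation_invariant_interval:
  assumes A[measurable]: "A \<in> sets borel"
    and inv: "\<And>q. q \<in> \<rat> \<Longrightarrow> AE t in uniform01. t \<in> A \<longleftrightarrow> frac (t + q) \<in> A"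
    and x: "0 \<le> x" "x \<le> 1"
  shows "measure uniform01 (A \<inter> {..<x}) = x * measure uniform01 A"
proof -
  interpret prob_space uniform01 by (rule prob_space_uniform01)
  define f where "f y = prob (A \<inter> {..<y})" for y
  have piece: "prob (A \<inter> {real k / n..<real (Suc k) / n}) = f (1 / n)"
    if "k < n" for k n :: nat
  proof -
    let ?R = "\<lambda>t. frac (t + real k / n)" and ?J = "A \<inter> {real k / n..<real (Suc k) / n}"
    have R: "?R \<in> measurable uniform01 borel" by measurable
    have "prob ?J = measure (distr uniform01 borel ?R) ?J"
      by (simp only: distr_uniform01_rotation)
    also have "\<dots> = prob (?R -` ?J \<inter> space uniform01)"
      by (rule measure_distr[OF R]) simp
    also have "\<dots> = f (1 / n)" unfolding f_def
    proof (rule measure_eq_AE)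
      have "real k / n \<in> \<rat>" by simp
      from inv[OF this] AE_uniform01_bounds
      show "AE t in uniform01. (t \<in> ?R -` ?J \<inter> space uniform01) = (t \<in> A \<inter> {..<1 / n})"
      proof eventually_elim
        case (elim t)
        have "?R t \<in> {real k / n..<real (Suc k) / n} \<longleftrightarrow> t < 1 / n"
        proof
          assume R: "?R t \<in> {real k / n..<real (Suc k) / n}"
          have "\<lfloor>t + real k / n\<rfloor> = 0 \<or> \<lfloor>t + real k / n\<rfloor> = 1"
          proof -
            have "0 \<le> real k / n" "real k / n < 1" using that by auto
            then show ?thesis using elim by linarith
          qed
          then show "t < 1 / n" using R elim by (auto simp: frac_def add_divide_distrib)
        next
          assume t: "t < 1 / n"
          have "real (Suc k) / n \<le> 1" using that by simp
          then have "frac (t + real k / n) = t + real k / n"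
            using t elim by (simp add: frac_eq add_divide_distrib)
          then show "?R t \<in> {real k / n..<real (Suc k) / n}"
            using t elim by (simp add: add_divide_distrib)
        qed
        then show ?case using elim by auto
      qed
    qed (use measurable_sets[OF R, of ?J] in simp_all)
    finally show ?thesis .
  qed
  have f0: "f 0 = 0"
  proof -
    have "f 0 = prob {}" unfolding f_def
      by (rule measure_eq_AE) (use AE_uniform01_bounds in \<open>auto elim: eventually_mono\<close>)
    then show ?thesis by simp
  qed
  have f1: "f 1 = prob A" unfolding f_def
    by (rule measure_eq_AE) (use AE_uniform01_bounds in \<open>auto elim: eventually_mono\<close>)
  have fk: "f (real k / n) = k * f (1 / n)" if "k \<le> n" "n > 0" for k n :: nat
    using that(1)
  proof (induction k)
    case 0
    then show ?case by (simp add: f0)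
  next
    case (Suc k)
    have "f b = f a + prob (A \<inter> {a..<b})" if "a \<le> b" for a b
    proof -
      have un: "A \<inter> {..<b} = A \<inter> {..<a} \<union> A \<inter> {a..<b}" using that by auto
      have disj: "(A \<inter> {..<a}) \<inter> (A \<inter> {a..<b}) = {}" by auto
      have "prob (A \<inter> {..<a} \<union> A \<inter> {a..<b}) = prob (A \<inter> {..<a}) + prob (A \<inter> {a..<b})"
        by (rule finite_measure_Union[OF _ _ disj]) simp_all
      then show ?thesis by (simp only: f_def un)
    qed
    then have "f (real (Suc k) / n) = f (real k / n) + prob (A \<inter> {real k / n..<real (Suc k) / n})"
      using divide_right_mono[of "real k" "real (Suc k)" "real n"] by simp
    also have "\<dots> = real k * f (1 / n) + f (1 / n)" using Suc piece[of k n] by simp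
    finally show ?case by (simp add: algebra_simps)
  qed
  have fkn: "f (real k / n) = real k / n * prob A" if "k \<le> n" "n > 0" for k n :: nat
  proof -
    have "real n * f (1 / n) = prob A" using fk[of n n] that f1 by simp
    then have "f (1 / n) = prob A / n" using that by (simp add: field_simps)
    then show ?thesis using fk[OF that] by simp
  qed
  have mono: "f y \<le> f z" if "y \<le> z" for y z
    unfolding f_def by (rule finite_measure_mono) (use that in auto)
  have "\<bar>f x - x * prob A\<bar> \<le> 1 / real n" if n: "n > 0" for n
  proof (cases "x = 1")
    case True
    then show ?thesis using f1 by simp
  next
    case False
    define k where "k = nat \<lfloor>real n * x\<rfloor>"
    have k: "real k \<le> real n * x" "real n * x < real k + 1" using x by (auto simp: k_def)
    have "real n * x < real n" using x False n by simp
    then have kn: "Suc k \<le> n" using k(1) by linarith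
    have l: "real k / n \<le> x" and u: "x \<le> real (Suc k) / n" using k n by (auto simp: field_simps)
    have "real k / n * prob A \<le> f x" using mono[OF l] fkn[of k n] kn n by simp
    moreover have "f x \<le> real (Suc k) / n * prob A" using mono[OF u] fkn[OF kn n] by simp
    moreover have "real k / n * prob A \<le> x * prob A" by (intro mult_right_mono l) simp
    moreover have "x * prob A \<le> real (Suc k) / n * prob A" by (intro mult_right_mono u) simp
    moreover have "real (Suc k) / n * prob A = real k / n * prob A + prob A / n"
      by (simp add: add_divide_distrib distrib_right)
    moreover have "prob A / n \<le> 1 / n" by (rule divide_right_mono[OF prob_le_1]) simp
    ultimately show ?thesis by linarith
  qed
  then have le: "\<bar>f x - x * prob A\<bar> \<le> 1 / real (Suc n)" for n by blast
  have "\<not> 0 < \<bar>f x - x * prob A\<bar>"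
  proof
    assume "0 < \<bar>f x - x * prob A\<bar>"
    then obtain n where "1 / real (Suc n) < \<bar>f x - x * prob A\<bar>" by (rule nat_approx_posE)
    with le[of n] show False by linarith
  qed
  then show ?thesis by (simp add: f_def)
qed

text \<open>An invariant set is independent of every half-line. If it is not null, conditioning on
  it leaves the distribution function unchanged, hence the measure itself; but the conditional
  measure gives the complement of \<open>A\<close> mass 0.\<close>

lemma uniform01_rational_rotation_ergodic:
  assumes A[measurable]: "A \<in> sets borel"
    and inv: "\<And>q. q \<in> \<rat> \<Longrightarrow> AE t in uniform01. t \<in> A \<longleftrightarrow> frac (t + q) \<in> A"
  shows "measure uniform01 A = 0 \<or> measure uniform01 A = 1"
proof (rule disjCI)
  interpret prob_space uniform01 by (rule prob_space_uniform01)
  assume "prob A \<noteq> 1"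
  show "prob A = 0"
  proof (rule ccontr)
    assume p: "prob A \<noteq> 0"
    define V where "V = uniform_measure uniform01 A"
    have mV: "measure V B = prob (A \<inter> B) / prob A" if "B \<in> sets borel" for B
      unfolding V_def using p that by (subst measure_uniform_measure) (auto simp: emeasure_eq_measure)
    have "prob_space V" unfolding V_def
      by (rule prob_space_uniform_measure) (use p in \<open>auto simp: emeasure_eq_measure\<close>)
    then have rV: "real_distribution V"
      by (auto simp: real_distribution_def real_distribution_axioms_def V_def)
    have rU: "real_distribution uniform01"
      using prob_space_uniform01 by (auto simp: real_distribution_def real_distribution_axioms_def)
    have inter: "prob (B \<inter> {..x}) = prob B * prob {..x}"
      if B[measurable]: "B \<in> sets borel" and Binv: "\<And>q. q \<in> \<rat> \<Longrightarrow> AE t in uniform01. t \<in> B \<longleftrightarrow> frac (t + q) \<in> B" for B x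
    proof -
      \<comment> \<open>The measure lives on the unit interval, so clamping \<open>x\<close> changes
        the half-line by a null set only. The instance for \<open>UNIV\<close> identifies
        \<open>prob {..x}\<close> with \<open>y\<close>.\<close>
      define y where "y = max 0 (min 1 x)"
      have y: "0 \<le> y" "y \<le> 1" by (auto simp: y_def)
      have "AE t in uniform01. t \<noteq> x"
      proof -
        have "AE t in lborel. t \<in> {0..<1} \<longrightarrow> t \<noteq> x"
          using AE_lborel_singleton[of x] by eventually_elim simp
        then show ?thesis by (simp add: AE_uniform_measure)
      qed
      with AE_uniform01_bounds have ae: "AE t in uniform01. t \<le> x \<longleftrightarrow> t < y"
        by eventually_elim (auto simp: y_def)
      have "prob (E \<inter> {..x}) = prob (E \<inter> {..<y})" if [measurable]: "E \<in> sets borel" for E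
        by (rule measure_eq_AE) (use ae in \<open>auto elim: eventually_mono\<close>)
      from this[of B] this[of UNIV] show ?thesis
        using uniform01_rotation_invariant_interval[OF B Binv y]
          uniform01_rotation_invariant_interval[of UNIV, OF _ _ y] prob_space by simp
    qed
    have "V = uniform01"
    proof (rule cdf_unique[OF rV rU], rule ext)
      fix x show "cdf V x = cdf uniform01 x"
        using inter[OF A inv, of x] p by (simp add: cdf_def mV)
    qed
    then have "measure V (- A) = prob (- A)" by simp
    then have "prob (- A) = 0" by (simp add: mV)
    then have "prob A = 1" using prob_compl[of A] by (simp add: Compl_eq_Diff_UNIV)
    then show False using \<open>prob A \<noteq> 1\<close> by simp
  qed
qed

section \<open>Standard probability spaces and the circle\<close>

text \<open>The tail after the \<open>k\<close>-th digit is at most 1/3, so the floor cuts it off,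
  and all earlier digits carry a positive power of 4, so parity shows the \<open>k\<close>-th digit.
  Base 2 would fail, since a tail of ones sums to 1; base 3 would spoil the parity.\<close>

lemma base4_digit:
  fixes b :: "nat \<Rightarrow> nat"
  assumes b: "\<And>k. b k \<le> 1"
  shows "odd \<lfloor>4 ^ Suc k * (\<Sum>j. real (b j) * (1/4) ^ Suc j)\<rfloor> \<longleftrightarrow> b k = 1"
proof -
  have sm: "summable (\<lambda>j. real (c j) * (1/4) ^ Suc j)" and
    sm_le: "(\<Sum>j. real (c j) * (1/4) ^ Suc j) \<le> 1/3" if c: "\<And>k. c k \<le> 1" for c :: "nat \<Rightarrow> nat"
  proof -
    have g: "(\<lambda>j. (1/4::real) ^ Suc j) sums (1/3)"
      using sums_mult[OF geometric_sums[of "1/4::real"], of "1/4"] by simp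
    have le: "real (c j) * (1/4) ^ Suc j \<le> (1/4) ^ Suc j" for j
      using c[of j] by (intro mult_left_le_one_le) auto
    show s: "summable (\<lambda>j. real (c j) * (1/4) ^ Suc j)"
      by (rule summable_comparison_test[OF _ sums_summable[OF g]]) (use le in auto)
    show "(\<Sum>j. real (c j) * (1/4) ^ Suc j) \<le> 1/3"
      using suminf_le[OF le s sums_summable[OF g]] sums_unique[OF g] by simp
  qed
  let ?r = "\<Sum>j. real (b (j + Suc k)) * (1/4) ^ Suc j"
  define N where "N = (\<Sum>j<k. int (b j) * 4 ^ (k - j)) + int (b k)"
  have "4 ^ Suc k * (\<Sum>j. real (b j) * (1/4) ^ Suc j)
      = 4 ^ Suc k * (\<Sum>j. real (b (j + Suc k)) * (1/4) ^ Suc (j + Suc k))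
        + 4 ^ Suc k * (\<Sum>j<Suc k. real (b j) * (1/4) ^ Suc j)"
    by (subst suminf_split_initial_segment[OF sm[OF b], where k = "Suc k"]) (simp only: distrib_left)
  also have "4 ^ Suc k * (\<Sum>j. real (b (j + Suc k)) * (1/4) ^ Suc (j + Suc k)) = ?r"
  proof -
    have "(\<Sum>j. real (b (j + Suc k)) * (1/4) ^ Suc (j + Suc k))
        = (\<Sum>j. (1/4) ^ Suc k * (real (b (j + Suc k)) * (1/4) ^ Suc j))"
      by (intro suminf_cong) (simp add: power_add)
    also have "\<dots> = (1/4) ^ Suc k * ?r" by (rule suminf_mult[OF sm]) (rule b)
    finally show ?thesis by (simp add: power_divide)
  qed
  also have "4 ^ Suc k * (\<Sum>j<Suc k. real (b j) * (1/4) ^ Suc j) = of_int N"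
  proof -
    have "4 ^ Suc k * (real (b j) * (1/4) ^ Suc j) = real (b j) * 4 ^ (k - j)" if "j \<le> k" for j
    proof -
      have "(4::real) ^ Suc k = 4 ^ (k - j) * 4 ^ Suc j"
        using that by (simp flip: power_add)
      then show ?thesis by (simp add: power_divide)
    qed
    then have "4 ^ Suc k * (\<Sum>j<Suc k. real (b j) * (1/4) ^ Suc j) = (\<Sum>j<Suc k. real (b j) * 4 ^ (k - j))"
      unfolding sum_distrib_left by (intro sum.cong) auto
    then show ?thesis by (simp add: N_def)
  qed
  finally have eq: "4 ^ Suc k * (\<Sum>j. real (b j) * (1/4) ^ Suc j) = ?r + of_int N" .
  have "0 \<le> ?r" by (rule suminf_nonneg[OF sm]) (use b in auto)
  moreover have "?r \<le> 1/3" by (rule sm_le) (rule b)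
  ultimately have "\<lfloor>?r + of_int N\<rfloor> = N" by (intro floor_unique) linarith+
  moreover have "even (\<Sum>j<k. int (b j) * 4 ^ (k - j))" by (rule dvd_sum) auto
  moreover have "b k = 0 \<or> b k = 1" using b[of k] by linarith
  ultimately show ?thesis unfolding eq by (auto simp: N_def)
qed

text \<open>
  The \<open>k\<close>-th base 4 digit of \<open>h x\<close> records whether \<open>x\<close> lies in the \<open>k\<close>-th of countably many balls, and \<open>\<delta>\<close>
  follows these digits along shrinking balls. Having a measurable left inverse that is defined on all
  of \<open>\<real>\<close> avoids the Lusin--Souslin theorem.
\<close>

lemma standard_borel_retract_real:
  fixes M :: "'a measure"
  assumes M: "standard_borel M" and ne: "space M \<noteq> {}"
  obtains h :: "'a \<Rightarrow> real" and \<delta> :: "real \<Rightarrow> 'a"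
  where "h \<in> borel_measurable M" "\<delta> \<in> measurable borel M" "\<And>x. x \<in> space M \<Longrightarrow> \<delta> (h x) = x"
proof -
  obtain X where X: "topspace X = space M" "completely_metrizable_space X" "separable_space X"
    and sets: "sets M = sigma_sets (space M) {U. openin X U}"
    using M by (auto simp: standard_borel_def)
  obtain S d where "Metric_space S d" and complete: "Metric_space.mcomplete S d"
    and Xeq: "X = Metric_space.mtopology S d"
    using X(2) by (auto simp: completely_metrizable_space_def)
  then interpret Metric_space S d by simp
  have S: "S = space M" using X(1) Xeq by simp
  obtain D where D: "countable D" "D \<subseteq> S" "mtopology closure_of D = S"
    using X(3) by (auto simp: separable_space_def Xeq)
  then have "D \<noteq> {}" using ne S by auto
  define q where "q = from_nat_into D"
  have qS: "q i \<in> S" for i using from_nat_into[OF \<open>D \<noteq> {}\<close>] D(2) by (auto simp: q_def)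
  have dense: "\<exists>i. d (q i) x < e" if x: "x \<in> S" and e: "e > 0" for x e
  proof -
    have "D \<inter> mball x e \<noteq> {}"
      using D(3) x e dense_intersects_open[of mtopology D] by (metis centre_in_mball_iff empty_iff openin_mball topspace_mtopology)
    then obtain y where "y \<in> D" "d x y < e" by auto
    then show ?thesis using from_nat_into_surj[OF D(1)] commute by (metis q_def)
  qed
  define U where "U k = mball (q (snd (prod_decode k))) (1 / real (Suc (fst (prod_decode k))))" for k
  have U_sets[measurable]: "U k \<in> sets M" for k
    unfolding sets by (rule sigma_sets.Basic) (simp add: Xeq U_def)
  define b :: "nat \<Rightarrow> 'a \<Rightarrow> nat" where "b k x = (if x \<in> U k then 1 else 0)" for k x
  define h where "h x = (\<Sum>k. real (b k x) * (1/4) ^ Suc k)" for x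
  have [measurable]: "h \<in> borel_measurable M" unfolding h_def b_def by measurable
  have digit: "odd \<lfloor>4 ^ Suc k * h x\<rfloor> \<longleftrightarrow> x \<in> U k" for k x
    using base4_digit[of "\<lambda>k. b k x" k] by (simp add: h_def b_def)
  \<comment> \<open>At \<open>t = h x\<close> this is the first index of a dense point within
    \<open>1 / Suc m\<close> of \<open>x\<close>. For other \<open>t\<close> there may be no such
    index and the value is arbitrary, but the function remains Borel in \<open>t\<close>.\<close>
  define \<iota> where "\<iota> m t = (LEAST i. odd \<lfloor>4 ^ Suc (prod_encode (m, i)) * t\<rfloor>)" for m and t :: real
  have [measurable]: "\<iota> m \<in> measurable borel (count_space UNIV)" for m
    unfolding \<iota>_def by measurable
  define p where "p m t = q (\<iota> m t)" for m t
  have dp[measurable]: "(\<lambda>t. d (p n t) (p m t)) \<in> borel_measurable borel" for n m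
    unfolding p_def by measurable
  have dq[measurable]: "(\<lambda>t. d (q i) (p m t)) \<in> borel_measurable borel" for i m
    unfolding p_def by measurable
  \<comment> \<open>The Cauchy condition with countable quantifiers only, which makes it a Borel
    condition on \<open>t\<close>. Where it fails, \<open>\<delta>\<close> takes the default value
    \<open>q 0\<close>.\<close>
  define K where "K t \<longleftrightarrow> (\<forall>e. \<exists>N. \<forall>n\<ge>N. \<forall>n'\<ge>N. d (p n t) (p n' t) < 1 / real (Suc e))" for t
  have K[measurable]: "Measurable.pred borel K" unfolding K_def by measurable
  have K_iff: "K t \<longleftrightarrow> MCauchy (\<lambda>m. p m t)" for t
  proof
    assume Kt: "K t"
    show "MCauchy (\<lambda>m. p m t)"
      unfolding MCauchy_def
    proof (intro conjI allI impI)
      show "range (\<lambda>m. p m t) \<subseteq> S" using qS by (auto simp: p_def)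
      fix e :: real assume "e > 0"
      then obtain n where n: "1 / real (Suc n) < e" using nat_approx_posE by blast
      obtain N where "\<forall>n1\<ge>N. \<forall>n2\<ge>N. d (p n1 t) (p n2 t) < 1 / real (Suc n)" using Kt unfolding K_def by blast
      then show "\<exists>N. \<forall>n n'. N \<le> n \<longrightarrow> N \<le> n' \<longrightarrow> d (p n t) (p n' t) < e"
        using n by (meson less_trans)
    qed
  next
    assume "MCauchy (\<lambda>m. p m t)"
    then have c: "\<exists>N. \<forall>n n'. N \<le> n \<longrightarrow> N \<le> n' \<longrightarrow> d (p n t) (p n' t) < e" if "e > 0" for e
      using that by (simp add: MCauchy_def)
    show "K t" unfolding K_def
    proof
      fix e
      show "\<exists>N. \<forall>n\<ge>N. \<forall>n'\<ge>N. d (p n t) (p n' t) < 1 / real (Suc e)"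
        using c[of "1 / real (Suc e)"] by auto
    qed
  qed
  define \<delta> where "\<delta> t = (if K t then (SOME l. limitin mtopology (\<lambda>m. p m t) l sequentially) else q 0)" for t
  have lim: "limitin mtopology (\<lambda>m. p m t) (\<delta> t) sequentially" if "K t" for t
  proof -
    have "\<exists>l. limitin mtopology (\<lambda>m. p m t) l sequentially"
      using that complete by (simp add: K_iff mcomplete_def)
    from someI_ex[OF this] show ?thesis using that by (simp add: \<delta>_def)
  qed
  have \<delta>S: "\<delta> t \<in> S" for t
  proof (cases "K t")
    case True
    then show ?thesis using limitin_mspace[OF lim] by simp
  qed (simp add: \<delta>_def qS)
  have dlim: "(\<lambda>m. if K t then d (q i) (p m t) else d (q i) (q 0)) \<longlonglongrightarrow> d (q i) (\<delta> t)" for i t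
  proof (cases "K t")
    case True
    have conv: "(\<lambda>m. d (p m t) (\<delta> t)) \<longlonglongrightarrow> 0"
      using lim[OF True] by (simp add: limitin_metric_dist_null)
    have le: "norm (d (q i) (p m t) - d (q i) (\<delta> t)) \<le> d (p m t) (\<delta> t)" for m
    proof -
      have "d (q i) (\<delta> t) \<le> d (q i) (p m t) + d (p m t) (\<delta> t)"
        by (rule triangle) (simp_all add: p_def qS \<delta>S)
      moreover have "d (q i) (p m t) \<le> d (q i) (\<delta> t) + d (\<delta> t) (p m t)"
        by (rule triangle) (simp_all add: p_def qS \<delta>S)
      ultimately show ?thesis using commute[of "p m t" "\<delta> t"] by simp
    qed
    have "(\<lambda>m. d (q i) (p m t) - d (q i) (\<delta> t)) \<longlonglongrightarrow> 0"
      by (rule Lim_null_comparison[OF always_eventually conv]) (rule allI, rule le)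
    then show ?thesis using True LIM_zero_iff by auto
  qed (simp add: \<delta>_def)
  have d\<delta>[measurable]: "(\<lambda>t. d (q i) (\<delta> t)) \<in> borel_measurable borel" for i
    by (rule borel_measurable_LIMSEQ_real[OF dlim]) measurable
  have "\<delta> \<in> measurable borel M"
  proof (rule measurable_sigma_sets[OF sets])
    show "{U. openin X U} \<subseteq> Pow (space M)" using openin_subset X(1) by fastforce
    show "\<delta> \<in> space borel \<rightarrow> space M" using \<delta>S S by simp
    fix V assume "V \<in> {U. openin X U}"
    then have V: "openin mtopology V" by (simp add: Xeq)
    \<comment> \<open>An open set is the union of the countably many balls \<open>U k\<close> inside
      it, and the preimage of a ball is Borel because the distance from \<open>\<delta> t\<close> to
      each \<open>q i\<close> is.\<close>
    define J where "J = {k. U k \<subseteq> V}"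
    have "V = (\<Union>k\<in>J. U k)"
    proof
      show "V \<subseteq> (\<Union>k\<in>J. U k)"
      proof
        fix x assume x: "x \<in> V"
        then obtain r where r: "r > 0" "mball x r \<subseteq> V" using V by (auto simp: openin_mtopology)
        have xS: "x \<in> S" using V x openin_subset by fastforce
        obtain m where m: "1 / real (Suc m) < r / 2" using nat_approx_posE[of "r/2"] r by auto
        obtain i where i: "d (q i) x < 1 / real (Suc m)" using dense[OF xS, of "1 / real (Suc m)"] by auto
        have "U (prod_encode (m, i)) \<subseteq> mball x r"
        proof
          fix y assume "y \<in> U (prod_encode (m, i))"
          then have y: "y \<in> S" "d (q i) y < 1 / real (Suc m)" by (auto simp: U_def)
          have "d x y \<le> d (q i) x + d (q i) y" using triangle[OF xS qS y(1), of i] commute by simp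
          then show "y \<in> mball x r" using y i m xS by auto
        qed
        moreover have "x \<in> U (prod_encode (m, i))" using i xS qS by (simp add: U_def)
        ultimately show "x \<in> (\<Union>k\<in>J. U k)" using r(2) by (auto simp: J_def)
      qed
    qed (auto simp: J_def)
    then have "\<delta> -` V \<inter> space borel = (\<Union>k\<in>J. {t \<in> space borel. d (q (snd (prod_decode k))) (\<delta> t) < 1 / real (Suc (fst (prod_decode k)))})"
      using qS \<delta>S by (auto simp: U_def)
    also have "\<dots> \<in> sets borel" by measurable
    finally show "\<delta> -` V \<inter> space borel \<in> sets borel" .
  qed
  moreover have "\<delta> (h x) = x" if x: "x \<in> space M" for x
  proof -
    have near: "d (p m (h x)) x < 1 / real (Suc m)" for m
    proof -
      have \<iota>: "\<iota> m (h x) = (LEAST i. x \<in> U (prod_encode (m, i)))" by (simp add: \<iota>_def digit del: power_Suc)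
      have xS: "x \<in> S" using x S by simp
      obtain i where "d (q i) x < 1 / real (Suc m)" using dense[OF xS, of "1 / real (Suc m)"] by auto
      then have "x \<in> U (prod_encode (m, i))" using xS qS by (simp add: U_def)
      then have "x \<in> U (prod_encode (m, \<iota> m (h x)))" unfolding \<iota> by (rule LeastI)
      then show ?thesis by (simp add: U_def p_def)
    qed
    have "limitin mtopology (\<lambda>m. p m (h x)) x sequentially"
      unfolding limitin_metric_dist_null
    proof (intro conjI)
      show "\<forall>\<^sub>F m in sequentially. p m (h x) \<in> S" using qS by (simp add: p_def)
      show "(\<lambda>m. d (p m (h x)) x) \<longlonglongrightarrow> 0"
        by (rule tendsto_sandwich[OF _ _ tendsto_const LIMSEQ_inverse_real_of_nat])
          (use near in \<open>auto intro!: always_eventually less_imp_le simp: inverse_eq_divide\<close>)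
    qed (use x S in simp)
    moreover from this have "K (h x)"
      unfolding K_iff by (rule convergent_imp_MCauchy[rotated]) (use qS in \<open>auto simp: p_def\<close>)
    ultimately show ?thesis
      using limitin_metric_unique[OF lim _ sequentially_bot] by blast
  qed
  ultimately show thesis using that \<open>h \<in> borel_measurable M\<close> by blast
qed


text \<open>The image \<open>\<nu>\<close> of the measure under \<open>h\<close> is an atomless
  distribution on \<real>, so its distribution function and its quantile function are inverse to
  each other off null sets. Composing them with \<open>h\<close> and its left inverse
  \<open>\<delta>\<close> gives the two maps.\<close>

lemma standard_prob_space_iso_uniform01:
  fixes M :: "'a measure"
  assumes "standard_prob_space M"
  obtains \<phi> :: "'a \<Rightarrow> real" and \<psi> :: "real \<Rightarrow> 'a"
  where "\<phi> \<in> borel_measurable M" "\<psi> \<in> measurable borel M"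
    "distr M borel \<phi> = uniform01" "distr uniform01 M \<psi> = M"
    "AE x in M. \<psi> (\<phi> x) = x" "AE t in uniform01. \<phi> (\<psi> t) = t"
proof -
  have std: "standard_borel M" and na: "nonatomic M" and "prob_space M"
    using assms by (auto simp: standard_prob_space_def)
  interpret prob_space M by fact
  obtain h :: "'a \<Rightarrow> real" and \<delta> :: "real \<Rightarrow> 'a"
    where h[measurable]: "h \<in> borel_measurable M" and \<delta>[measurable]: "\<delta> \<in> measurable borel M"
      and \<delta>h: "\<And>x. x \<in> space M \<Longrightarrow> \<delta> (h x) = x"
    using standard_borel_retract_real[OF std not_empty] by blast
  define \<nu> where "\<nu> = distr M borel h"
  interpret \<nu>: cdf_distribution \<nu>
    unfolding cdf_distribution_def \<nu>_def by (rule real_distribution_distr) (rule h)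
  \<comment> \<open>A fibre of \<open>h\<close> has at most the one point \<open>\<delta> s\<close>.
    If it had positive measure, a nonempty subset of strictly smaller measure would be
    impossible.\<close>
  have atom: "measure \<nu> {s} = 0" for s
  proof -
    let ?E = "h -` {s} \<inter> space M"
    have sub: "?E \<subseteq> {\<delta> s}" using \<delta>h by auto
    have "emeasure M ?E = 0"
    proof (rule ccontr)
      assume "emeasure M ?E \<noteq> 0"
      then obtain B where B: "B \<subseteq> ?E" "0 < emeasure M B" "emeasure M B < emeasure M ?E"
        using na h by (auto simp: nonatomic_def measurable_sets zero_less_iff_neq_zero)
      then have "B \<noteq> {}" by auto
      then have "B = {\<delta> s}" using subset_singletonD[OF subset_trans[OF B(1) sub]] by simp
      then have "B = ?E" using B(1) sub by (intro subset_antisym) simp_all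
      then show False using B(3) by simp
    qed
    then show ?thesis by (simp add: \<nu>_def measure_distr measure_def emeasure_distr)
  qed
  have F_cont: "isCont (cdf \<nu>) s" for s using \<nu>.isCont_cdf atom by simp
  \<comment> \<open>The quantile function satisfies \<open>t \<le> C s\<close> iff
    \<open>I t \<le> s\<close>. Only a jump of \<open>C\<close> at \<open>I t\<close> could make
    \<open>C (I t)\<close> exceed \<open>t\<close>, and continuity excludes it.\<close>
  have FI: "\<nu>.C (\<nu>.I t) = t" if t: "0 < t" "t < 1" for t
  proof (rule antisym)
    show "t \<le> \<nu>.C (\<nu>.I t)" by (rule \<nu>.pseudoinverse[OF t, THEN iffD2]) (rule order_refl)
    have "(\<nu>.C \<longlongrightarrow> \<nu>.C (\<nu>.I t)) (at_left (\<nu>.I t))"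
      using F_cont[of "\<nu>.I t"] by (simp add: isCont_def filterlim_at_split)
    moreover have "\<forall>\<^sub>F s in at_left (\<nu>.I t). \<nu>.C s \<le> t"
    proof -
      have "\<nu>.C s \<le> t" if "s < \<nu>.I t" for s using \<nu>.pseudoinverse[OF t, of s] that by linarith
      then show ?thesis by (auto simp: eventually_at_filter)
    qed
    ultimately show "\<nu>.C (\<nu>.I t) \<le> t" by (intro tendsto_upperbound) auto
  qed
  \<comment> \<open>The value 0 outside the open interval is a default that makes \<open>Q\<close> a
    Borel function on all of \<real>.\<close>
  define Q where "Q t = (if t \<in> {0<..<1} then \<nu>.I t else 0)" for t
  have Q[measurable]: "Q \<in> borel_measurable borel"
    unfolding Q_def using \<nu>.measurable_CI by (subst (asm) measurable_restrict_space_iff) auto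
  have distr_Q: "distr uniform01 borel Q = \<nu>"
  proof (rule measure_eqI)
    fix A assume "A \<in> sets (distr uniform01 borel Q)"
    then have A[measurable]: "A \<in> sets borel" by simp
    have "emeasure (distr uniform01 borel Q) A = emeasure lborel ({0..<1} \<inter> (Q -` A))"
      using measurable_sets[OF Q A] by (simp add: emeasure_distr divide_ennreal_def)
    also have "\<dots> = emeasure lborel ({0<..<1} \<inter> (Q -` A))"
    proof (rule emeasure_eq_AE)
      show "AE x in lborel. (x \<in> {0..<1} \<inter> Q -` A) = (x \<in> {0<..<1} \<inter> Q -` A)"
        using AE_lborel_singleton[of "0::real"] by eventually_elim auto
    qed (use measurable_sets[OF Q A] in auto)
    also have "{0<..<1} \<inter> (Q -` A) = \<nu>.I -` A \<inter> {0<..<1}" by (auto simp: Q_def)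
    also have "emeasure lborel \<dots> = emeasure (distr (restrict_space lborel {0<..<1}) borel \<nu>.I) A"
      by (subst emeasure_distr) (auto simp: space_restrict_space emeasure_restrict_space)
    finally show "emeasure (distr uniform01 borel Q) A = emeasure \<nu> A" by (simp add: \<nu>.distr_I_eq_M)
  qed (simp add: \<nu>_def)
  have FQ: "AE t in uniform01. \<nu>.C (Q t) = t" using AE_uniform01_bounds by eventually_elim (simp add: Q_def FI)
  have [measurable]: "\<nu>.C \<in> borel_measurable borel" by (rule \<nu>.measurable_C)
  have distr_h: "distr \<nu> N f = distr M N (\<lambda>x. f (h x))" if "f \<in> measurable borel N" for N :: "'b measure" and f
    using that unfolding \<nu>_def by (subst distr_distr) (simp_all add: comp_def)
  have distr_Q': "distr \<nu> N f = distr uniform01 N (\<lambda>t. f (Q t))" if "f \<in> measurable borel N" for N :: "'b measure" and f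
    using that unfolding distr_Q[symmetric] by (subst distr_distr) (simp_all add: comp_def)
  have AE_h: "(AE s in \<nu>. P s) \<longleftrightarrow> (AE x in M. P (h x))" if "Measurable.pred borel P" for P
    using that unfolding \<nu>_def by (subst AE_distr_iff) simp_all
  have AE_Q: "(AE s in \<nu>. P s) \<longleftrightarrow> (AE t in uniform01. P (Q t))" if "Measurable.pred borel P" for P
    using that unfolding distr_Q[symmetric] by (subst AE_distr_iff) simp_all
  show thesis
  proof
    show "(\<lambda>x. \<nu>.C (h x)) \<in> borel_measurable M" by measurable
    show "(\<lambda>t. \<delta> (Q t)) \<in> measurable borel M" by measurable
    have "distr M borel (\<lambda>x. \<nu>.C (h x)) = distr uniform01 borel (\<lambda>t. \<nu>.C (Q t))"
      by (simp flip: distr_h distr_Q')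
    also have "\<dots> = distr uniform01 borel (\<lambda>t. t)"
      by (rule distr_cong_AE) (use FQ in simp_all)
    also have "\<dots> = uniform01" by (rule distr_id2) simp
    finally show "distr M borel (\<lambda>x. \<nu>.C (h x)) = uniform01" .
    have "distr uniform01 M (\<lambda>t. \<delta> (Q t)) = distr M M (\<lambda>x. \<delta> (h x))"
      by (simp flip: distr_h distr_Q')
    also have "\<dots> = distr M M (\<lambda>x. x)" by (rule distr_cong) (simp_all add: \<delta>h)
    finally show "distr uniform01 M (\<lambda>t. \<delta> (Q t)) = M" by (simp add: distr_id2)
    \<comment> \<open>Since \<open>\<nu>\<close> is the image of \<open>uniform01\<close> under
      \<open>Q\<close>, it is enough to look at \<open>s = Q t\<close>, where
      \<open>C (Q t) = t\<close> applies. The identity \<open>h (\<delta> s) = s\<close> below is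
      obtained in the same way from \<open>s = h x\<close>.\<close>
    have "AE s in \<nu>. Q (\<nu>.C s) = s" by (subst AE_Q) (use FQ in auto)
    then have "AE x in M. Q (\<nu>.C (h x)) = h x" by (subst (asm) AE_h) auto
    then show "AE x in M. \<delta> (Q (\<nu>.C (h x))) = x" using AE_space by eventually_elim (simp add: \<delta>h)
    have "AE x in M. h (\<delta> (h x)) = h x" by (rule AE_I2) (simp add: \<delta>h)
    then have "AE s in \<nu>. h (\<delta> s) = s" by (subst AE_h) auto
    then have "AE t in uniform01. h (\<delta> (Q t)) = Q t" by (subst (asm) AE_Q) auto
    with FQ show "AE t in uniform01. \<nu>.C (h (\<delta> (Q t))) = t" by eventually_elim simp
  qed
qed

section \<open>Transformations of a measure space modulo null sets\<close>

text \<open>Rotations transported to \<open>M\<close> are invertible only almost everywhere, whereas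
  the group consists of bijections of the whole space. The defect is repaired by the identity off a
  conull set that is stable under \<open>S\<close> and \<open>S'\<close> and on which they are
  mutually inverse.\<close>

lemma mp_bij_group_AE_representative:
  assumes S[measurable]: "S \<in> measurable M M" and S'[measurable]: "S' \<in> measurable M M"
    and dS: "distr M M S = M" and dS': "distr M M S' = M"
    and inv1: "AE x in M. S' (S x) = x" and inv2: "AE x in M. S (S' x) = x"
  shows "\<exists>T\<in>carrier (mp_bij_group M). AE x in M. T x = S x"
proof -
  have "AE x in M. S' (S x) = x \<and> S (S' x) = x" using inv1 inv2 by eventually_elim simp
  then obtain N where N: "{x \<in> space M. \<not> (S' (S x) = x \<and> S (S' x) = x)} \<subseteq> N" "emeasure M N = 0" "N \<in> sets M"
    by (rule AE_E)
  define B where "B = space M - N"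
  have [measurable]: "B \<in> sets M" using N by (simp add: B_def)
  have aeB: "AE x in M. x \<in> B"
  proof -
    have "N \<in> null_sets M" using N by (simp add: null_sets_def)
    from AE_not_in[OF this] AE_space show ?thesis by eventually_elim (simp add: B_def)
  qed
  have B: "S' (S x) = x" "S (S' x) = x" if "x \<in> B" for x using that N(1) by (auto simp: B_def)
  have pow[measurable]: "(R ^^ n) \<in> measurable M M" if "R \<in> measurable M M" for R n
    by (induction n) (use that in \<open>auto simp: id_def comp_def intro: measurable_compose\<close>)
  have AE_comp: "AE x in M. P (R x)" if "R \<in> measurable M M" "distr M M R = M" "AE x in M. P x" for R P
    by (rule AE_distrD[OF that(1)]) (simp only: that)
  have AE_pow: "AE x in M. (R ^^ n) x \<in> B" if "R \<in> measurable M M" "distr M M R = M" for R n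
  proof (induction n)
    case 0
    then show ?case using aeB by simp
  next
    case (Suc n)
    from AE_comp[OF that this] show ?case by (simp add: funpow_swap1)
  qed
  \<comment> \<open>Restricted to the points whose entire orbit avoids the exceptional null set, \<open>S\<close> is a bijection.\<close>
  define Y where "Y = {x \<in> space M. \<forall>n. (S ^^ n) x \<in> B \<and> (S' ^^ n) x \<in> B}"
  have [measurable]: "Y \<in> sets M" unfolding Y_def using pow[OF S] pow[OF S'] by measurable
  have aeY: "AE x in M. x \<in> Y"
  proof -
    have "AE x in M. \<forall>n. (S ^^ n) x \<in> B \<and> (S' ^^ n) x \<in> B"
      unfolding AE_all_countable using AE_pow[OF S dS] AE_pow[OF S' dS'] by (auto intro: AE_conjI)
    then show ?thesis using AE_space by eventually_elim (simp add: Y_def)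
  qed
  have YB: "x \<in> B" if "x \<in> Y" for x
    using that unfolding Y_def by (auto dest: spec[of _ 0])
  have YS: "S x \<in> Y" and YS': "S' x \<in> Y" if x: "x \<in> Y" for x
  proof -
    have xs: "x \<in> space M" and p: "(S ^^ n) x \<in> B" "(S' ^^ n) x \<in> B" for n using x by (auto simp: Y_def)
    have "(S ^^ n) (S x) \<in> B" for n using p(1)[of "Suc n"] by (simp add: funpow_swap1)
    moreover have "(S' ^^ n) (S x) \<in> B" for n
    proof (cases n)
      case 0
      then show ?thesis using p(1)[of 1] by simp
    next
      case (Suc m)
      then show ?thesis using p(2)[of m] B(1)[OF YB[OF x]] by (simp add: funpow_swap1)
    qed
    ultimately show "S x \<in> Y" using measurable_space[OF S xs] by (simp add: Y_def)
    have "(S' ^^ n) (S' x) \<in> B" for n using p(2)[of "Suc n"] by (simp add: funpow_swap1)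
    moreover have "(S ^^ n) (S' x) \<in> B" for n
    proof (cases n)
      case 0
      then show ?thesis using p(2)[of 1] by simp
    next
      case (Suc m)
      then show ?thesis using p(1)[of m] B(2)[OF YB[OF x]] by (simp add: funpow_swap1)
    qed
    ultimately show "S' x \<in> Y" using measurable_space[OF S' xs] by (simp add: Y_def)
  qed
  have Ysub: "Y \<subseteq> space M" by (auto simp: Y_def)
  define T where "T = restrict (\<lambda>x. if x \<in> Y then S x else x) (space M)"
  define T' where "T' = (\<lambda>x. if x \<in> Y then S' x else x)"
  have T_space: "T x \<in> space M" "T' x \<in> space M" if "x \<in> space M" for x
    using that YS YS' Ysub by (auto simp: T_def T'_def)
  have T'T: "T' (T x) = x" and TT': "T (T' x) = x" if "x \<in> space M" for x
    using that YS YS' Ysub B YB by (auto simp: T_def T'_def)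
  have bij: "bij_betw T (space M) (space M)"
    by (rule bij_betw_byWitness[where f' = T']) (use T'T TT' T_space in auto)
  have Tm[measurable]: "T \<in> measurable M M"
  proof -
    have "(\<lambda>x. if x \<in> Y then S x else x) \<in> measurable M M" by measurable
    then show ?thesis by (rule measurable_cong[THEN iffD1, rotated]) (simp add: T_def)
  qed
  have inv_eq: "inv_into (space M) T x = T' x" if "x \<in> space M" for x
    using inv_into_f_f[of T "space M" "T' x"] bij T_space(2)[OF that] TT'[OF that] by (simp add: bij_betw_def)
  have "inv_into (space M) T \<in> measurable M M"
  proof -
    have "T' \<in> measurable M M" unfolding T'_def by measurable
    then show ?thesis by (rule measurable_cong[THEN iffD1, rotated]) (simp add: inv_eq)
  qed
  moreover have ae: "AE x in M. T x = S x" using aeY AE_space by eventually_elim (simp add: T_def)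
  moreover have "distr M M T = M"
    using distr_cong_AE[OF refl refl ae Tm S] dS by simp
  moreover have "T \<in> Bij (space M)" using bij by (simp add: Bij_def T_def)
  ultimately show ?thesis by (intro bexI[of _ T]) (simp_all add: mp_bij_group_def)
qed

lemma aut_class_hom: "aut_class M \<in> hom (mp_bij_group M) (Aut M)"
  unfolding Aut_def aut_class_def[abs_def] by (rule normal.r_coset_hom_Mod[OF ae_trivial_normal])

lemma aut_class_mult:
  assumes "S \<in> carrier (mp_bij_group M)" "T \<in> carrier (mp_bij_group M)"
  shows "aut_class M S \<otimes>\<^bsub>Aut M\<^esub> aut_class M T = aut_class M (S \<otimes>\<^bsub>mp_bij_group M\<^esub> T)"
  using hom_mult[OF aut_class_hom assms] by simp

lemma aut_class_inv:
  assumes "S \<in> carrier (mp_bij_group M)"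
  shows "inv\<^bsub>Aut M\<^esub> (aut_class M S) = aut_class M (inv\<^bsub>mp_bij_group M\<^esub> S)"
proof -
  interpret group_hom "mp_bij_group M" "Aut M" "aut_class M"
    by (rule group_hom.intro[OF group_mp_bij_group group_Aut group_hom_axioms.intro[OF aut_class_hom]])
  show ?thesis using hom_inv[OF assms] by simp
qed

lemma mp_bij_group_space:
  assumes "S \<in> carrier (mp_bij_group M)" "x \<in> space M"
  shows "S x \<in> space M"
  using measurable_space[OF mp_bij_groupD(2)[OF assms(1)] assms(2)] .

lemma mp_bij_group_inj:
  assumes "S \<in> carrier (mp_bij_group M)" "x \<in> space M" "y \<in> space M"
  shows "S x = S y \<longleftrightarrow> x = y"
  using mp_bij_groupD(1)[OF assms(1)] assms(2,3) by (auto simp: Bij_def bij_betw_def inj_on_def)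

section \<open>The full group of rotations\<close>

text \<open>Collects what is needed from the circle, so that the maps to and from it can be
  forgotten. In the last clause, points of \<open>M\<close> are compared through their real
  coordinates, which are faithful off a null set; this provides measurable coincidence sets.\<close>

lemma mp_bij_group_circle_action:
  fixes M :: "'a measure"
  assumes M: "standard_prob_space M"
  obtains T :: "real \<Rightarrow> 'a \<Rightarrow> 'a"
  where "\<And>h. T h \<in> carrier (mp_bij_group M)"
    "\<And>h k. AE x in M. T h (T k x) = T (h + k) x"
    "\<And>h k. AE x in M. T h x = T k x \<Longrightarrow> h - k \<in> \<int>"
    "\<And>A. A \<in> sets M \<Longrightarrow> \<forall>q\<in>\<rat>. AE x in M. x \<in> A \<longleftrightarrow> T q x \<in> A \<Longrightarrow> measure M A = 0 \<or> measure M A = 1"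
    "\<And>S S'. S \<in> carrier (mp_bij_group M) \<Longrightarrow> S' \<in> carrier (mp_bij_group M) \<Longrightarrow>
      \<exists>E\<in>sets M. AE x in M. x \<in> E \<longleftrightarrow> S x = S' x"
proof -
  obtain \<phi> :: "'a \<Rightarrow> real" and \<psi> :: "real \<Rightarrow> 'a" where \<phi>[measurable]: "\<phi> \<in> borel_measurable M"
    and \<psi>[measurable]: "\<psi> \<in> measurable borel M"
    and d\<phi>: "distr M borel \<phi> = uniform01" and d\<psi>: "distr uniform01 M \<psi> = M"
    and \<psi>\<phi>: "AE x in M. \<psi> (\<phi> x) = x" and \<phi>\<psi>: "AE t in uniform01. \<phi> (\<psi> t) = t"
    using standard_prob_space_iso_uniform01[OF M] .
  interpret prob_space M using M by (simp add: standard_prob_space_def)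
  have \<psi>': "\<psi> \<in> measurable uniform01 M" by simp
  define S where "S h x = \<psi> (frac (\<phi> x + h))" for h x
  have S[measurable]: "S h \<in> measurable M M" for h unfolding S_def by measurable
  have d_r\<phi>: "distr M borel (\<lambda>x. frac (\<phi> x + h)) = uniform01" for h
  proof -
    have "distr M borel (\<lambda>x. frac (\<phi> x + h)) = distr (distr M borel \<phi>) borel (\<lambda>t. frac (t + h))"
      by (subst distr_distr) (simp_all add: comp_def)
    then show ?thesis by (simp only: d\<phi> distr_uniform01_rotation)
  qed
  have dS: "distr M M (S h) = M" for h
  proof -
    have "distr M M (S h) = distr (distr M borel (\<lambda>x. frac (\<phi> x + h))) M \<psi>"
      by (subst distr_distr) (simp_all add: comp_def S_def[abs_def])
    then show ?thesis by (simp only: d_r\<phi> d\<psi>)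
  qed
  have AE_push: "AE x in M. P (frac (\<phi> x + h))" if "AE t in uniform01. P t" for P h
    by (rule AE_distrD[of _ _ borel]) (simp_all only: d_r\<phi> that, measurable)
  have AE_pull: "AE t in uniform01. P (\<psi> t)" if "AE x in M. P x" for P
    by (rule AE_distrD[OF \<psi>']) (simp only: d\<psi> that)
  have \<phi>S: "AE x in M. \<phi> (S h x) = frac (\<phi> x + h)" for h
    using AE_push[OF \<phi>\<psi>, of h] by (simp add: S_def)
  have SS: "AE x in M. S h (S k x) = S (h + k) x" for h k
    using \<phi>S[of k] by eventually_elim (simp add: S_def[of h] S_def[of "h + k"] frac_add_frac algebra_simps)
  have S0: "AE x in M. S 0 x = x"
  proof -
    have "AE x in M. 0 < \<phi> x \<and> \<phi> x < 1"
      using AE_uniform01_bounds unfolding d\<phi>[symmetric] by (subst (asm) AE_distr_iff) auto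
    with \<psi>\<phi> show ?thesis by eventually_elim (simp add: S_def frac_eq)
  qed
  have SSinv: "AE x in M. S (- h) (S h x) = x" for h
    using SS[of "- h" h] S0 by eventually_elim simp
  have "\<exists>T\<in>carrier (mp_bij_group M). AE x in M. T x = S h x" for h
    using mp_bij_group_AE_representative[OF S S dS dS SSinv] SSinv[of "- h"] by simp
  then obtain T where T: "\<And>h. T h \<in> carrier (mp_bij_group M)" and TS: "\<And>h. AE x in M. T h x = S h x"
    by metis
  show thesis
  proof
    show "T h \<in> carrier (mp_bij_group M)" for h by (rule T)
    show "AE x in M. T h (T k x) = T (h + k) x" for h k
      using mp_bij_group_AE_comp[OF T TS, of h k] TS[of k] TS[of "h + k"] SS[of h k]
      by eventually_elim simp
    show "h - k \<in> \<int>" if "AE x in M. T h x = T k x" for h k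
    proof -
      have "AE x in M. frac (\<phi> x + h) = frac (\<phi> x + k)"
        using that TS[of h] TS[of k] \<phi>S[of h] \<phi>S[of k] by eventually_elim simp
      then have "AE x in M. h - k \<in> \<int>"
        by eventually_elim (use frac_eq_imp_diff_Ints in fastforce)
      then show ?thesis by simp
    qed
    show "measure M A = 0 \<or> measure M A = 1"
      if A[measurable]: "A \<in> sets M" and inv: "\<forall>q\<in>\<rat>. AE x in M. x \<in> A \<longleftrightarrow> T q x \<in> A" for A
    proof -
      have "measure M A = measure (distr uniform01 M \<psi>) A" by (simp only: d\<psi>)
      also have "\<dots> = measure uniform01 (\<psi> -` A)" by (subst measure_distr[OF \<psi>' A]) simp
      finally have eq: "measure M A = measure uniform01 (\<psi> -` A)" .
      have "AE t in uniform01. t \<in> \<psi> -` A \<longleftrightarrow> frac (t + q) \<in> \<psi> -` A" if "q \<in> \<rat>" for q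
      proof -
        have "AE x in M. x \<in> A \<longleftrightarrow> S q x \<in> A" using bspec[OF inv that] TS[of q] by eventually_elim simp
        from AE_pull[OF this] \<phi>\<psi> show ?thesis by eventually_elim (simp add: S_def)
      qed
      moreover have "\<psi> -` A \<in> sets borel" using measurable_sets[OF \<psi> A] by simp
      ultimately show ?thesis unfolding eq by (intro uniform01_rational_rotation_ergodic)
    qed
    show "\<exists>E\<in>sets M. AE x in M. x \<in> E \<longleftrightarrow> R x = R' x"
      if R: "R \<in> carrier (mp_bij_group M)" "R' \<in> carrier (mp_bij_group M)" for R R'
    proof
      note [measurable] = R[THEN mp_bij_groupD(2)]
      show "{x \<in> space M. \<phi> (R x) = \<phi> (R' x)} \<in> sets M" by measurable
      show "AE x in M. x \<in> {x \<in> space M. \<phi> (R x) = \<phi> (R' x)} \<longleftrightarrow> R x = R' x"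
        using mp_bij_group_AE_comp[OF R(1) \<psi>\<phi>] mp_bij_group_AE_comp[OF R(2) \<psi>\<phi>] AE_space
      proof eventually_elim
        case (elim x)
        then have "\<phi> (R x) = \<phi> (R' x) \<longleftrightarrow> R x = R' x" by (metis (no_types))
        then show ?case using elim(3) by simp
      qed
    qed
  qed
qed

theorem corollary4p18:
  fixes M :: "'a measure"
  assumes "standard_prob_space M"
  shows "\<exists>G. full_group M G \<and> ergodic M G \<and> \<not> polishable ((Aut M)\<lparr>carrier := G\<rparr>)"
proof -
  interpret M: prob_space M using assms by (simp add: standard_prob_space_def)
  obtain T :: "real \<Rightarrow> 'a \<Rightarrow> 'a" where T: "\<And>h. T h \<in> carrier (mp_bij_group M)"
    and TT: "\<And>h k. AE x in M. T h (T k x) = T (h + k) x"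
    and T_free: "\<And>h k. AE x in M. T h x = T k x \<Longrightarrow> h - k \<in> \<int>"
    and T_ergodic: "\<And>A. A \<in> sets M \<Longrightarrow> \<forall>q\<in>\<rat>. AE x in M. x \<in> A \<longleftrightarrow> T q x \<in> A
      \<Longrightarrow> measure M A = 0 \<or> measure M A = 1"
    and T_eq: "\<And>S S'. S \<in> carrier (mp_bij_group M) \<Longrightarrow> S' \<in> carrier (mp_bij_group M) \<Longrightarrow>
      \<exists>E\<in>sets M. AE x in M. x \<in> E \<longleftrightarrow> S x = S' x"
    by (rule mp_bij_group_circle_action[OF assms]) (rule that)
  obtain H :: "real set" and L :: "real \<Rightarrow> real" where QH: "\<rat> \<subseteq> H" and H_unc: "uncountable H"
    and H_add: "\<And>x y. x \<in> H \<Longrightarrow> y \<in> H \<Longrightarrow> x + y \<in> H" and H_minus: "\<And>x. x \<in> H \<Longrightarrow> - x \<in> H"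
    and L_add: "\<And>x y. L (x + y) \<le> L x + L y" and L_minus: "\<And>x. L (- x) = L x"
    and L_nat: "\<And>n x. L (real n * x) = real n * L x"
    and L_gap: "\<And>x. x \<in> H \<Longrightarrow> L x = 0 \<or> 1 \<le> L x" and L_0: "\<And>x. L x = 0 \<longleftrightarrow> x \<in> \<rat>"
    by (rule uncountable_real_subgroup_length) (rule that)
  have H0: "0 \<in> H" using QH by auto
  note T_space = mp_bij_group_space[OF T]
  let ?B = "mp_bij_group M"
  interpret B: group ?B by (rule group_mp_bij_group)
  interpret A: group "Aut M" by (rule group_Aut)
  have T0: "AE x in M. T 0 x = x"
    using TT[of 0 0] AE_space by eventually_elim (auto simp: mp_bij_group_inj[OF T] T_space)
  \<comment> \<open>No measurable partition is mentioned: it suffices that almost every point is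
    moved by some member of a countable family. Closure under the group operations and under pasting
    then amounts to reindexing countable families in \<open>H\<close>.\<close>
  define local_in where "local_in S \<longleftrightarrow> (\<exists>k :: nat \<Rightarrow> real. range k \<subseteq> H \<and> (AE x in M. \<exists>n. S x = T (k n) x))" for S
  \<comment> \<open>\<open>G\<close> consists of the transformations acting piecewise, on countably many pieces, as some \<open>T h\<close> with \<open>h \<in> H\<close>.\<close>
  define G where "G = aut_class M ` {S \<in> carrier ?B. local_in S}"
  have memG: "aut_class M S \<in> G \<longleftrightarrow> local_in S" if S: "S \<in> carrier ?B" for S
  proof
    assume "aut_class M S \<in> G"
    then obtain R where R: "R \<in> carrier ?B" "local_in R" "aut_class M S = aut_class M R"
      by (auto simp: G_def)
    then have eq: "AE x in M. S x = R x" using aut_class_eq_iff[OF S R(1)] by simp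
    obtain k :: "nat \<Rightarrow> real" where k: "range k \<subseteq> H" "AE x in M. \<exists>n. R x = T (k n) x"
      using R(2) by (auto simp: local_in_def)
    from k(2) eq have "AE x in M. \<exists>n. S x = T (k n) x" by eventually_elim simp
    with k(1) show "local_in S" by (auto simp: local_in_def)
  qed (use S in \<open>auto simp: G_def\<close>)
  have G_elim: "\<exists>S. g = aut_class M S \<and> S \<in> carrier ?B \<and> local_in S" if "g \<in> G" for g
    using that by (auto simp: G_def)
  have local_T: "local_in (T h)" if "h \<in> H" for h
    unfolding local_in_def by (rule exI[of _ "\<lambda>_. h"]) (use that in auto)

  \<comment> \<open>Piecewise rotations under the group operations and under pasting\<close>
  have local_mult: "local_in (S \<otimes>\<^bsub>?B\<^esub> S')"
    if S: "S \<in> carrier ?B" "local_in S" and S': "S' \<in> carrier ?B" "local_in S'" for S S'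
  proof -
    obtain k :: "nat \<Rightarrow> real" where k: "range k \<subseteq> H" "AE x in M. \<exists>n. S x = T (k n) x"
      using S(2) by (auto simp: local_in_def)
    obtain l :: "nat \<Rightarrow> real" where l: "range l \<subseteq> H" "AE x in M. \<exists>n. S' x = T (l n) x"
      using S'(2) by (auto simp: local_in_def)
    have all: "AE x in M. \<forall>m n. T (k m) (T (l n) x) = T (k m + l n) x"
      using TT by (simp add: AE_all_countable)
    have "AE x in M. \<exists>n. (S \<otimes>\<^bsub>?B\<^esub> S') x = T (k (fst (prod_decode n)) + l (snd (prod_decode n))) x"
      using mp_bij_group_AE_comp[OF S'(1) k(2)] l(2) all mp_bij_group_AE_mult[OF S(1) S'(1)]
    proof eventually_elim
      case (elim x)
      then obtain m n where "S (S' x) = T (k m) (S' x)" "S' x = T (l n) x" by blast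
      then have "(S \<otimes>\<^bsub>?B\<^esub> S') x = T (k m + l n) x" using elim by simp
      then show ?case by (intro exI[of _ "prod_encode (m, n)"]) simp
    qed
    moreover have "range (\<lambda>n. k (fst (prod_decode n)) + l (snd (prod_decode n))) \<subseteq> H"
      using k(1) l(1) by (auto intro!: H_add)
    ultimately show ?thesis
      unfolding local_in_def by (intro exI[of _ "\<lambda>n. k (fst (prod_decode n)) + l (snd (prod_decode n))"]) simp
  qed
  have local_inv: "local_in (inv\<^bsub>?B\<^esub> S)" if S: "S \<in> carrier ?B" "local_in S" for S
  proof -
    let ?R = "inv\<^bsub>?B\<^esub> S"
    have R: "?R \<in> carrier ?B" using S(1) by simp
    obtain k :: "nat \<Rightarrow> real" where k: "range k \<subseteq> H" "AE x in M. \<exists>n. S x = T (k n) x"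
      using S(2) by (auto simp: local_in_def)
    have all: "AE x in M. \<forall>n. T (- k n) (T (k n) x) = T 0 x"
      using TT[of "- k n" "k n" for n] by (simp add: AE_all_countable)
    have "AE x in M. \<exists>n. ?R x = T (- k n) x"
      using mp_bij_group_AE_comp[OF R k(2)] mp_bij_group_AE_comp[OF R all] mp_bij_group_AE_comp[OF R T0] AE_space
    proof eventually_elim
      case (elim x)
      then obtain n where "S (?R x) = T (k n) (?R x)" by blast
      then have "x = T (k n) (?R x)" using mp_bij_group_inv_apply(2)[OF S(1)] elim(4) by simp
      then have "T (- k n) x = ?R x" using elim by metis
      then show ?case by metis
    qed
    then show ?thesis
      unfolding local_in_def using k(1) H_minus by (intro exI[of _ "\<lambda>n. - k n"]) auto
  qed
  have subG: "subgroup G (Aut M)"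
  proof (rule A.subgroupI)
    show "G \<subseteq> carrier (Aut M)" by (auto simp: G_def carrier_Aut)
    show "G \<noteq> {}" using local_T[OF H0] T by (auto simp: G_def)
    show "inv\<^bsub>Aut M\<^esub> g \<in> G" if g: "g \<in> G" for g
    proof -
      obtain S where "g = aut_class M S" "S \<in> carrier ?B" "local_in S" using G_elim[OF g] by blast
      then show ?thesis using local_inv[of S] by (simp add: aut_class_inv memG)
    qed
    show "g \<otimes>\<^bsub>Aut M\<^esub> g' \<in> G" if g: "g \<in> G" "g' \<in> G" for g g'
    proof -
      obtain S where "g = aut_class M S" "S \<in> carrier ?B" "local_in S" using G_elim[OF g(1)] by blast
      moreover obtain S' where "g' = aut_class M S'" "S' \<in> carrier ?B" "local_in S'" using G_elim[OF g(2)] by blast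
      ultimately show ?thesis using local_mult[of S S'] by (simp add: aut_class_mult memG)
    qed
  qed
  have "full_group M G"
    unfolding full_group_def
  proof (intro conjI allI ballI impI subG)
    fix S :: "nat \<Rightarrow> 'a \<Rightarrow> 'a" and A R
    assume R: "R \<in> carrier ?B" and S: "\<forall>n. S n \<in> carrier ?B \<and> aut_class M (S n) \<in> G"
      and un: "(\<Union>n. A n) = space M" and eq: "\<forall>n. AE x in M. x \<in> A n \<longrightarrow> R x = S n x"
    have "\<forall>n. \<exists>k :: nat \<Rightarrow> real. range k \<subseteq> H \<and> (AE x in M. \<exists>m. S n x = T (k m) x)"
      using S memG by (auto simp: local_in_def)
    then obtain k :: "nat \<Rightarrow> nat \<Rightarrow> real" where k: "\<And>n. range (k n) \<subseteq> H"
      "\<And>n. AE x in M. \<exists>m. S n x = T (k n m) x" by metis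
    have "AE x in M. \<forall>n. \<exists>m. S n x = T (k n m) x" using k(2) by (simp add: AE_all_countable)
    moreover have "AE x in M. \<forall>n. x \<in> A n \<longrightarrow> R x = S n x" using eq by (simp add: AE_all_countable)
    ultimately have "AE x in M. \<exists>i. R x = T (k (fst (prod_decode i)) (snd (prod_decode i))) x"
      using AE_space
    proof eventually_elim
      case (elim x)
      then have "x \<in> (\<Union>n. A n)" using un by simp
      then obtain n where "x \<in> A n" by blast
      then obtain m where "R x = T (k n m) x" using elim by metis
      then show ?case by (intro exI[of _ "prod_encode (n, m)"]) simp
    qed
    moreover have "range (\<lambda>i. k (fst (prod_decode i)) (snd (prod_decode i))) \<subseteq> H" using k(1) by auto
    ultimately show "aut_class M R \<in> G"
      unfolding memG[OF R] local_in_def by (intro exI[of _ "\<lambda>i. k (fst (prod_decode i)) (snd (prod_decode i))"]) simp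
  qed

  \<comment> \<open>Ergodicity through the rational rotations\<close>
  moreover have "ergodic M G"
    unfolding ergodic_def
  proof (intro ballI impI)
    fix E assume E[measurable]: "E \<in> sets M"
      and inv: "\<forall>S\<in>carrier ?B. aut_class M S \<in> G \<longrightarrow> measure M (sym_diff E (S ` E)) = 0"
    have Esub: "E \<subseteq> space M" using sets.sets_into_space[OF E] .
    show "measure M E = 0 \<or> measure M E = 1"
    proof (rule T_ergodic[OF E], rule ballI)
      fix q :: real assume "q \<in> \<rat>"
      then have "aut_class M (T q) \<in> G" using QH local_T memG[OF T] by blast
      then have zero: "measure M (sym_diff E (T q ` E)) = 0" using inv T by blast
      let ?I = "inv_into (space M) (T q)"
      have bij: "bij_betw (T q) (space M) (space M)" using mp_bij_groupD(1)[OF T] by (simp add: Bij_def)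
      \<comment> \<open>Viewing the image as a preimage under the measurable inverse makes it
        measurable; only then does measure 0 of the symmetric difference, stated with a real-valued
        measure, become an almost everywhere statement.\<close>
      have "T q ` E = ?I -` E \<inter> space M"
      proof (intro equalityI subsetI)
        fix y assume "y \<in> T q ` E"
        then show "y \<in> ?I -` E \<inter> space M" using Esub bij T_space by (auto simp: bij_betw_def)
      next
        fix y assume y: "y \<in> ?I -` E \<inter> space M"
        then have "y = T q (?I y)" using bij by (auto simp: bij_betw_def f_inv_into_f)
        then show "y \<in> T q ` E" using y by blast
      qed
      also have "\<dots> \<in> sets M" by (rule measurable_sets[OF mp_bij_groupD(3)[OF T] E])
      finally have TE[measurable]: "T q ` E \<in> sets M" .
      have "sym_diff E (T q ` E) \<in> null_sets M"
        using zero by (auto simp: null_sets_def M.emeasure_eq_measure)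
      then have "AE y in M. y \<notin> sym_diff E (T q ` E)" by (rule AE_not_in)
      from mp_bij_group_AE_comp[OF T this, of q] AE_space
      show "AE x in M. x \<in> E \<longleftrightarrow> T q x \<in> E"
      proof eventually_elim
        case (elim x)
        have "T q x \<in> T q ` E \<longleftrightarrow> x \<in> E"
          using mp_bij_group_inj[OF T elim(2)] Esub by (auto simp: image_iff)
        then show ?case using elim(1) by auto
      qed
    qed
  qed

  \<comment> \<open>The centralizer of the rational rotations and its length function\<close>
  moreover have "\<not> polishable ((Aut M)\<lparr>carrier := G\<rparr>)"
  proof
    let ?G = "(Aut M)\<lparr>carrier := G\<rparr>"
    assume "polishable ?G"
    then obtain X where X: "polish_group_topology ?G X" by (auto simp: polishable_def)
    interpret G: group ?G by (rule A.subgroup_imp_group[OF subG])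
    have top: "topspace X = G" and mult: "continuous_map (prod_topology X X) X (\<lambda>(g, h). g \<otimes>\<^bsub>Aut M\<^esub> h)"
      and cm: "completely_metrizable_space X"
      using X by (auto simp: polish_group_topology_def)
    define c where "c h = aut_class M (T h)" for h
    have cG: "c h \<in> G" if "h \<in> H" for h using that by (simp add: c_def memG T local_T)
    have c_eq: "c h = c k \<longleftrightarrow> (AE x in M. T h x = T k x)" for h k
      by (simp add: c_def aut_class_eq_iff T)
    have c_add: "c h \<otimes>\<^bsub>Aut M\<^esub> c k = c (h + k)" for h k
    proof -
      have "AE x in M. (T h \<otimes>\<^bsub>?B\<^esub> T k) x = T (h + k) x"
        using mp_bij_group_AE_mult[OF T T, of h k] TT[of h k] by eventually_elim simp
      then show ?thesis by (simp add: c_def aut_class_mult T aut_class_eq_iff)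
    qed
    have c_0: "c 0 = \<one>\<^bsub>?G\<^esub>"
      using G.l_cancel_one[of "c 0" "c 0"] c_add[of 0 0] cG[OF H0] by simp
    have c_minus: "inv\<^bsub>?G\<^esub> (c h) = c (- h)" if "h \<in> H" for h
      by (rule G.inv_equality) (use that c_add[of "- h" h] c_0 cG H_minus in simp_all)
    have c_pow: "c h [^]\<^bsub>?G\<^esub> (n::nat) = c (real n * h)" for h n
    proof (induction n)
      case 0
      then show ?case using c_0 by simp
    next
      case (Suc n)
      then show ?case using c_add[of "real n * h" h] by (simp add: algebra_simps)
    qed
    define C where "C = c ` H"
    have subC: "subgroup C ?G"
    proof (rule G.subgroupI)
      show "C \<subseteq> carrier ?G" using cG by (auto simp: C_def)
      show "C \<noteq> {}" using H0 by (auto simp: C_def)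
      show "inv\<^bsub>?G\<^esub> g \<in> C" if "g \<in> C" for g using that c_minus H_minus by (auto simp: C_def)
      show "g \<otimes>\<^bsub>?G\<^esub> g' \<in> C" if "g \<in> C" "g' \<in> C" for g g'
        using that by (auto simp: C_def c_add intro!: imageI H_add)
    qed
    have centralizer: "C = (\<Inter>q\<in>\<rat>. {g \<in> topspace X. g \<otimes>\<^bsub>Aut M\<^esub> c q = c q \<otimes>\<^bsub>Aut M\<^esub> g})"
    proof (intro equalityI subsetI)
      fix g assume "g \<in> C"
      then show "g \<in> (\<Inter>q\<in>\<rat>. {g \<in> topspace X. g \<otimes>\<^bsub>Aut M\<^esub> c q = c q \<otimes>\<^bsub>Aut M\<^esub> g})"
        using cG by (auto simp: C_def c_add top add.commute)
    next
      fix g assume g: "g \<in> (\<Inter>q\<in>\<rat>. {g \<in> topspace X. g \<otimes>\<^bsub>Aut M\<^esub> c q = c q \<otimes>\<^bsub>Aut M\<^esub> g})"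
      then have "g \<in> G" using top Rats_0 by blast
      then obtain S where S: "g = aut_class M S" "S \<in> carrier ?B" "local_in S" using G_elim by blast
      obtain k :: "nat \<Rightarrow> real" where k: "range k \<subseteq> H" "AE x in M. \<exists>n. S x = T (k n) x"
        using S(3) by (auto simp: local_in_def)
      have comm: "AE x in M. S (T q x) = T q (S x)" if "q \<in> \<rat>" for q
      proof -
        have "g \<otimes>\<^bsub>Aut M\<^esub> c q = c q \<otimes>\<^bsub>Aut M\<^esub> g" using g that by blast
        then have "AE x in M. (S \<otimes>\<^bsub>?B\<^esub> T q) x = (T q \<otimes>\<^bsub>?B\<^esub> S) x"
          using S T by (simp add: c_def aut_class_mult aut_class_eq_iff)
        then show ?thesis
          using mp_bij_group_AE_mult[OF S(2) T, of q] mp_bij_group_AE_mult[OF T S(2), of q]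
          by eventually_elim simp
      qed
      have "\<forall>n. \<exists>E\<in>sets M. AE x in M. x \<in> E \<longleftrightarrow> S x = T (k n) x"
        using T_eq[OF S(2) T] by blast
      then obtain E where E: "\<And>n. E n \<in> sets M" "\<And>n. AE x in M. x \<in> E n \<longleftrightarrow> S x = T (k n) x"
        by metis
      \<comment> \<open>\<open>S\<close> commutes with \<open>T q\<close> by assumption and
        \<open>T (k n)\<close> does as a rotation. Injectivity of \<open>T q\<close> then makes
        agreement at \<open>x\<close> equivalent to agreement at \<open>T q x\<close>.\<close>
      have zero_one: "measure M (E n) = 0 \<or> measure M (E n) = 1" for n
      proof (rule T_ergodic[OF E(1)], rule ballI)
        fix q :: real assume q: "q \<in> \<rat>"
        show "AE x in M. x \<in> E n \<longleftrightarrow> T q x \<in> E n"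
          using E(2)[of n] mp_bij_group_AE_comp[OF T E(2), of q n] comm[OF q] TT[of q "k n"] TT[of "k n" q] AE_space
        proof eventually_elim
          case (elim x)
          have "T q x \<in> E n \<longleftrightarrow> T q (S x) = T q (T (k n) x)" using elim by (simp add: add.commute)
          also have "\<dots> \<longleftrightarrow> S x = T (k n) x"
            using elim(6) by (intro mp_bij_group_inj[OF T] T_space mp_bij_group_space[OF S(2)])
          finally show ?case using elim(1) by simp
        qed
      qed
      have "\<exists>n. measure M (E n) = 1"
      proof (rule ccontr)
        assume "\<nexists>n. measure M (E n) = 1"
        then have "E n \<in> null_sets M" for n
          using zero_one[of n] E(1)[of n] by (auto simp: null_sets_def M.emeasure_eq_measure)
        then have "AE x in M. \<forall>n. x \<notin> E n" by (simp add: AE_all_countable AE_not_in)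
        moreover have "AE x in M. \<forall>n. x \<in> E n \<longleftrightarrow> S x = T (k n) x" using E(2) by (simp add: AE_all_countable)
        ultimately have "AE x in M. False" using k(2) by eventually_elim auto
        then show False by simp
      qed
      then obtain n where "measure M (E n) = 1" ..
      then have "AE x in M. x \<in> E n" using M.AE_prob_1 by simp
      with E(2)[of n] have "AE x in M. S x = T (k n) x" by eventually_elim simp
      then have "g = c (k n)" using S T by (simp add: c_def aut_class_eq_iff)
      then show "g \<in> C" using k(1) by (auto simp: C_def)
    qed
    have "closedin X C"
      unfolding centralizer
    proof (rule closedin_INT)
      show "\<rat> \<noteq> ({} :: real set)" using Rats_0 by blast
      fix q :: real assume "q \<in> \<rat>"
      then have "c q \<in> topspace X" using QH cG top by blast
      then have "continuous_map X (prod_topology X X) (\<lambda>g. (g, c q))"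
        "continuous_map X (prod_topology X X) (\<lambda>g. (c q, g))"
        by (intro continuous_map_pairedI; simp)+
      from this[THEN continuous_map_compose[OF _ mult]]
      have "continuous_map X X (\<lambda>g. g \<otimes>\<^bsub>Aut M\<^esub> c q)" "continuous_map X X (\<lambda>g. c q \<otimes>\<^bsub>Aut M\<^esub> g)"
        by (simp_all add: o_def)
      then show "closedin X {g \<in> topspace X. g \<otimes>\<^bsub>Aut M\<^esub> c q = c q \<otimes>\<^bsub>Aut M\<^esub> g}"
        by (rule closedin_continuous_maps_eq[OF metrizable_imp_Hausdorff_space[OF
              completely_metrizable_imp_metrizable_space[OF cm]]])
    qed
    \<comment> \<open>An element of \<open>C\<close> determines its angle only up to an integer. The
      choice is harmless: \<open>L\<close> vanishes on \<rat>, so by subadditivity it is constant on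
      cosets of \<rat>.\<close>
    define l where "l g = L (SOME h. h \<in> H \<and> g = c h)" for g
    have l_c: "l (c h) = L h" if h: "h \<in> H" for h
    proof -
      define k where "k = (SOME k. k \<in> H \<and> c h = c k)"
      have "k \<in> H \<and> c h = c k" unfolding k_def by (rule someI[of _ h]) (use h in simp)
      then have "AE x in M. T h x = T k x" by (simp add: c_eq)
      then have "h - k \<in> \<rat>" using T_free Ints_subset_Rats by blast
      then have "L (h - k) = 0" "L (k - h) = 0" using L_0 L_minus[of "h - k"] by auto
      then have "L h = L k" using L_add[of "h - k" k] L_add[of "k - h" h] by simp
      then show ?thesis by (simp add: l_def k_def)
    qed
    have "countable C"
    proof (rule polish_group_length_countable[OF G.group_axioms X subC \<open>closedin X C\<close>, of l])
      show "l (x \<otimes>\<^bsub>?G\<^esub> y) \<le> l x + l y" if "x \<in> C" "y \<in> C" for x y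
        using that L_add by (auto simp: C_def c_add l_c H_add)
      show "l (inv\<^bsub>?G\<^esub> x) = l x" if "x \<in> C" for x
        using that by (auto simp: C_def c_minus l_c H_minus L_minus)
      show "l (x [^]\<^bsub>?G\<^esub> n) = real n * l x" if x: "x \<in> C" for x and n :: nat
      proof -
        have nH: "real n * h \<in> H" if "h \<in> H" for h
          by (induction n) (use that H0 H_add in \<open>auto simp: distrib_right\<close>)
        show ?thesis using x by (auto simp: C_def c_pow l_c nH L_nat)
      qed
      show "l x = 0 \<or> 1 \<le> l x" if x: "x \<in> C" for x
      proof -
        obtain h where "h \<in> H" "x = c h" using x by (auto simp: C_def)
        then show ?thesis using L_gap[of h] by (simp add: l_c)
      qed
      have "{x \<in> C. l x = 0} \<subseteq> c ` \<rat>" by (auto simp: C_def l_c L_0)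
      then show "countable {x \<in> C. l x = 0}" by (rule countable_subset) (simp add: countable_rat)
    qed
    \<comment> \<open>Each fibre of \<open>c\<close> on \<open>H\<close> lies in a single coset of
      \<rat>, so a countable \<open>C\<close> would leave only countably many elements of
      \<open>H\<close>.\<close>
    moreover have "H \<subseteq> (\<Union>g\<in>C. (\<lambda>q. q + inv_into H c g) ` \<rat>)"
    proof
      fix h assume h: "h \<in> H"
      let ?k = "inv_into H c (c h)"
      have "c h = c ?k" using f_inv_into_f[of "c h" c H] h by simp
      then have "h - ?k \<in> \<rat>" using T_free Ints_subset_Rats unfolding c_eq by blast
      then have "h \<in> (\<lambda>q. q + ?k) ` \<rat>" by (intro image_eqI[of _ _ "h - ?k"]) auto
      then show "h \<in> (\<Union>g\<in>C. (\<lambda>q. q + inv_into H c g) ` \<rat>)" using h by (auto simp: C_def)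
    qed
    moreover have "countable (\<Union>g\<in>C. (\<lambda>q. q + inv_into H c g) ` \<rat>)"
      using \<open>countable C\<close> countable_rat by (intro countable_UN countable_image)
    ultimately show False using H_unc countable_subset by metis
  qed
  ultimately show ?thesis by blast
qed

end
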